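(* Let $X=\prod_{i=1}^d X_i\subseteq\mathbb{R}^n$ with each $X_i\subseteq\mathbb{R}^{n_i}$ nonempty, closed and convex (possibly unbounded), $\sum_{i=1}^d n_i=n$. Let $f:\mathbb{R}^n\to\mathbb{R}$ be continuously differentiable and $\mu_f$-strongly convex over $X$ ($\mu_f>0$), with $\nabla f$ Lipschitz with parameter $L_f>0$ on $X$. Let $F:\mathbb{R}^n\to\mathbb{R}^n$ be continuous and monotone over $X$, and suppose there exist nonnegative scalars $L_F$ and $B_F$ such that $\|F(x)-F(y)\|^2\le L_F^2\|x-y\|^2+B_F$ for all $x,y\in X$. Suppose $\mathrm{SOL}(X,F)$ is nonempty, and let $x^*$ denote the unique optimal solution of the problem of minimizing $f(x)$ subject to $x\in\mathrm{SOL}(X,F)$. Let $\{\bar x_k\}$ be generated by the aRB-IRG algorithm (described in the context), started from a random initial point $x_0\in X$, with block indices $i_k$ drawn from the uniform distribution on $\{1,\ldots,d\}$ for all $k\ge0$. Let $$\gamma_k=\gamma_0(k+1)^{-a},\qquad \eta_k=\eta_0(k+1)^{-b}\qquad\text{for all } k\ge 0,$$ where $\gamma_0>0$, $\eta_0>0$, $0<b<0.5<a$ and $a+b<1$. Then, for all values $0\le r<1$ of the averaging parameter $r$ of the algorithm: (i) The sequence $\{\bar x_k\}$ converges almost surely to $x^*$. (ii) $\lim_{k\to\infty}\mathsf{E}[\|\bar x_k-x^*\|]=0$.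
   Context: Notation. $\|\cdot\|$ is the Euclidean norm; a vector $x\in\mathbb{R}^n$ is partitioned into blocks $x=(x^{(1)};\ldots;x^{(d)})$ with $x^{(i)}\in\mathbb{R}^{n_i}$; $F_i(x)$ and $\nabla_i f(x)$ are the $i$-th blocks of $F(x)$ and $\nabla f(x)$. $\mathcal{P}_S$ is the Euclidean projection onto a closed convex set $S$. $F$ is monotone on $X$ if $(F(x)-F(y))^T(x-y)\ge 0$ for all $x,y\in X$. $f$ is $\mu_f$-strongly convex over $X$ if $f(x)\ge f(y)+\nabla f(y)^T(x-y)+\frac{\mu_f}{2}\|x-y\|^2$ for all $x,y\in X$. $\mathrm{SOL}(X,F)$ is the set of all $x\in X$ with $F(x)^T(y-x)\ge 0$ for all $y\in X$. Under the stated hypotheses $\mathrm{SOL}(X,F)$ is nonempty, closed and convex, so $x^*$ exists and is unique. Algorithm aRB-IRG (for differentiable $f$). Input: a random initial point $x_0\in X$, $\bar x_0:=x_0$, positive sequences $\{\gamma_k\}$ (stepsizes) and $\{\eta_k\}$ (regularization parameters), a scalar $0\le r<1$, $S_0:=\gamma_0^r$. The block indices $i_0,i_1,\ldots$ are independent and identically distributed (here uniform on $\{1,\ldots,d\}$), with $i_k$ independent of the history $\{x_0,i_0,\ldots,i_{k-1}\}$. For $k=0,1,\ldots$: $$x_{k+1}^{(i)}:=\begin{cases}\mathcal{P}_{X_{i_k}}\!\left(x_k^{(i_k)}-\gamma_k\left(F_{i_k}(x_k)+\eta_k\nabla_{i_k}f(x_k)\right)\right)& i=i_k,\\ x_k^{(i)}&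 i\ne i_k,\end{cases}$$ $$S_{k+1}:=S_k+\gamma_{k+1}^r,\qquad \bar x_{k+1}:=\frac{S_k\bar x_k+\gamma_{k+1}^r x_{k+1}}{S_{k+1}}.$$
   Formalization: Part (ii) is stated for an integrable random initial point x_0 (E‖x_0‖ finite); without this the expectations in (ii) can be infinite for all k, e.g. X = R, F = 0, f = x²/2, γ_0η_0 < 1. Part (i) needs no such condition. *)

theory Defs
  imports "HOL-Probability.Probability"
begin

text \<open>
  A partition of the coordinates of \<open>\<real>\<^sup>n\<close> into blocks is a map \<open>\<beta> :: 'n \<Rightarrow> 'd\<close> sending each
  coordinate to the index of its block, so that \<open>n = CARD('n)\<close>, \<open>d = CARD('d)\<close> and
  \<open>n\<^sub>i = card {j. \<beta> j = i}\<close>. As the block sizes may differ, an \<open>n\<^sub>i\<close>-dimensional block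
  vector is represented by its isometric copy in \<open>real ^ 'n\<close>, padded by zeros
  outside block \<open>i\<close>; the copy of the whole block space is \<open>range (block \<beta> i)\<close>.
\<close>

definition block :: "('n \<Rightarrow> 'd) \<Rightarrow> 'd \<Rightarrow> real ^ 'n \<Rightarrow> real ^ 'n" where
  "block \<beta> i x = (\<chi> j. if \<beta> j = i then x $ j else 0)"

definition block_prod :: "('n \<Rightarrow> 'd) \<Rightarrow> ('d \<Rightarrow> (real ^ 'n) set) \<Rightarrow> (real ^ 'n) set" where
  "block_prod \<beta> Xs = {x. \<forall>i. block \<beta> i x \<in> Xs i}"

definition vi_monotone_on :: "'a::real_inner set \<Rightarrow> ('a \<Rightarrow> 'a) \<Rightarrow> bool" where
  "vi_monotone_on X F \<longleftrightarrow> (\<forall>x\<in>X. \<forall>y\<in>X. (F x - F y) \<bullet> (x - y) \<ge> 0)"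

text \<open>In the following definition \<open>g\<close> is meant to be the gradient of \<open>f\<close>.\<close>

definition strongly_convex_on :: "real \<Rightarrow> 'a::real_inner set \<Rightarrow> ('a \<Rightarrow> real) \<Rightarrow> ('a \<Rightarrow> 'a) \<Rightarrow> bool" where
  "strongly_convex_on \<mu> X f g \<longleftrightarrow>
     (\<forall>x\<in>X. \<forall>y\<in>X. f x \<ge> f y + g y \<bullet> (x - y) + \<mu> / 2 * (norm (x - y))\<^sup>2)"

definition SOL :: "'a::real_inner set \<Rightarrow> ('a \<Rightarrow> 'a) \<Rightarrow> 'a set" where
  "SOL X F = {x \<in> X. \<forall>y\<in>X. F x \<bullet> (y - x) \<ge> 0}"

text \<open>
  Independence of two random variables with values in possibly different types
  (the library's \<open>indep_var\<close> requires a common value type).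
\<close>

definition indep_rv :: "'w measure \<Rightarrow> 'a measure \<Rightarrow> ('w \<Rightarrow> 'a) \<Rightarrow> 'b measure \<Rightarrow> ('w \<Rightarrow> 'b) \<Rightarrow> bool" where
  "indep_rv M N Y K Z \<longleftrightarrow> Y \<in> measurable M N \<and> Z \<in> measurable M K \<and>
     prob_space.indep_set M {Y -` A \<inter> space M | A. A \<in> sets N} {Z -` B \<inter> space M | B. B \<in> sets K}"

text \<open>
  The iterates of aRB-IRG along one realization: \<open>x\<^sub>0\<close> is the initial point, \<open>idx k\<close> the block
  index drawn in iteration \<open>k\<close>, and \<open>g\<close> the gradient of the regularizing objective \<open>f\<close>.
  In \<open>closest_point (Xs i)\<close> the zero padding is harmless: for \<open>Xs i \<subseteq> range (block \<beta> i)\<close> it is the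
  projection within the block space.
\<close>

primrec aRB_iter ::
  "('n::finite \<Rightarrow> 'd) \<Rightarrow> ('d \<Rightarrow> (real ^ 'n) set) \<Rightarrow> (real ^ 'n \<Rightarrow> real ^ 'n) \<Rightarrow> (real ^ 'n \<Rightarrow> real ^ 'n) \<Rightarrow>
   (nat \<Rightarrow> real) \<Rightarrow> (nat \<Rightarrow> real) \<Rightarrow> real ^ 'n \<Rightarrow> (nat \<Rightarrow> 'd) \<Rightarrow> nat \<Rightarrow> real ^ 'n" where
  "aRB_iter \<beta> Xs F g \<gamma> \<eta> x0 idx 0 = x0"
| "aRB_iter \<beta> Xs F g \<gamma> \<eta> x0 idx (Suc k) =
     (let x = aRB_iter \<beta> Xs F g \<gamma> \<eta> x0 idx k;
          i = idx k;
          p = closest_point (Xs i)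
                (block \<beta> i x - \<gamma> k *\<^sub>R (block \<beta> i (F x) + \<eta> k *\<^sub>R block \<beta> i (g x)))
      in (\<chi> j. if \<beta> j = i then p $ j else x $ j))"

primrec weight_sum :: "(nat \<Rightarrow> real) \<Rightarrow> real \<Rightarrow> nat \<Rightarrow> real" where
  "weight_sum \<gamma> r 0 = \<gamma> 0 powr r"
| "weight_sum \<gamma> r (Suc k) = weight_sum \<gamma> r k + \<gamma> (Suc k) powr r"

primrec weighted_avg :: "(nat \<Rightarrow> real) \<Rightarrow> real \<Rightarrow> (nat \<Rightarrow> 'a::real_vector) \<Rightarrow> nat \<Rightarrow> 'a" where
  "weighted_avg \<gamma> r x 0 = x 0"
| "weighted_avg \<gamma> r x (Suc k) =
     (weight_sum \<gamma> r k *\<^sub>R weighted_avg \<gamma> r x k + \<gamma> (Suc k) powr r *\<^sub>R x (Suc k))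
       /\<^sub>R weight_sum \<gamma> r (Suc k)"

end

theory Submission
  imports Defs
begin

text \<open>
  The iterates are compared with the Tikhonov trajectory: \<open>y\<^sub>k\<close> solves the variational inequality of
  \<open>F + \<eta>\<^sub>k g\<close> on \<open>X\<close>. It exists by Brouwer's theorem and coercivity, converges to \<open>x\<^sup>*\<close> and moves by
  at most \<open>O(1/k)\<close> per step. Averaging over the random block, \<open>e\<^sub>k = \<parallel>x\<^sub>k - y\<^sub>k\<parallel>\<^sup>2\<close> satisfies
  \<open>E[e\<^sub>k\<^sub>+\<^sub>1 | past] \<le> (1 - t\<^sub>k) e\<^sub>k + \<theta>\<^sub>k\<close> for large \<open>k\<close>, where \<open>t\<^sub>k = \<gamma>\<^sub>k \<eta>\<^sub>k \<mu> / d\<close> is not summable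
  (\<open>a + b < 1\<close>) but \<open>\<theta>\<^sub>k = O(\<gamma>\<^sub>k\<^sup>2 + 1/(k\<^sup>2 t\<^sub>k))\<close> is (\<open>a > 1/2\<close> and \<open>a + b < 1\<close>). Hence the means of \<open>e\<^sub>k\<close>
  tend to \<open>0\<close>, and a maximal inequality for almost supermartingales upgrades this to almost sure
  convergence. As \<open>x\<^sub>0\<close> need not be square integrable, \<open>e\<^sub>k\<close> is multiplied throughout by a weight
  \<open>w(x\<^sub>0)\<close>: \<open>1 / (1 + \<parallel>x\<^sub>0\<parallel>\<^sup>2)\<close> suffices for almost sure convergence, and \<open>1 / (1 + \<parallel>x\<^sub>0\<parallel>)\<close> combined with
  the Cauchy-Schwarz inequality gives convergence in mean when \<open>x\<^sub>0\<close> is integrable. The weighted averages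
  of the iterates inherit both limits because their weights \<open>\<gamma>\<^sub>k\<^sup>r\<close> are not summable.
\<close>

section \<open>Real sequences and weighted averages\<close>

text \<open>Adding the tail sums \<open>T\<close> of \<open>\<theta>\<close> turns \<open>v\<close>
  into a decreasing sequence \<open>u\<close> whose decrements dominate \<open>s k * v k\<close>. A
  positive limit of \<open>v\<close> would therefore bound \<open>s\<close> eventually by a multiple
  of a telescoping series, against its divergence.\<close>

lemma recursion_tendsto_zero:
  fixes v s \<theta> :: "nat \<Rightarrow> real"
  assumes v: "\<And>k. 0 \<le> v k"
    and s: "\<And>k. 0 \<le> s k" "\<not> summable s"
    and \<theta>: "summable \<theta>" "\<And>k. 0 \<le> \<theta> k"
    and rec: "\<And>k. v (Suc k) \<le> (1 - s k) * v k + \<theta> k"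
  shows "v \<longlonglongrightarrow> 0"
proof -
  define T where "T k = (\<Sum>j. \<theta> (j + k))" for k
  define u where "u k = v k + T k" for k
  have T_lim: "T \<longlonglongrightarrow> 0"
    unfolding T_def using suminf_exist_split2[OF \<theta>(1)] .
  have T_nonneg: "0 \<le> T k" for k
    unfolding T_def by (intro suminf_nonneg summable_ignore_initial_segment \<theta>)
  have T_Suc: "T k = \<theta> k + T (Suc k)" for k
    unfolding T_def using suminf_split_head[of "\<lambda>j. \<theta> (j + k)"] \<theta>(1)
    by (simp add: summable_ignore_initial_segment)
  have sv: "s k * v k \<le> u k - u (Suc k)" for k
    using rec[of k] T_Suc[of k] by (simp add: u_def algebra_simps)
  have "decseq u"
    unfolding decseq_Suc_iff
  proof
    fix k
    have "0 \<le> s k * v k" using s v by simp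
    then show "u (Suc k) \<le> u k" using sv[of k] by linarith
  qed
  moreover have "\<And>k. 0 \<le> u k" by (simp add: u_def v T_nonneg)
  ultimately obtain L where L: "u \<longlonglongrightarrow> L" using decseq_convergent[of u 0] by metis
  have vL: "v \<longlonglongrightarrow> L"
    using tendsto_diff[OF L T_lim] by (simp add: u_def)
  have "0 \<le> L" using LIMSEQ_le_const[OF vL] v by blast
  moreover have "\<not> 0 < L"
  proof
    assume "0 < L"
    then have ev: "\<forall>\<^sub>F k in sequentially. L / 2 < v k"
      using order_tendstoD(1)[OF vL, of "L / 2"] by simp
    have "summable (\<lambda>k. (2 / L) * (u k - u (Suc k)))"
      using telescope_summable'[OF L] by (rule summable_mult)
    moreover have "\<forall>\<^sub>F k in sequentially. norm (s k) \<le> (2 / L) * (u k - u (Suc k))"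
      using ev
    proof eventually_elim
      case (elim k)
      have "s k * (L / 2) \<le> s k * v k" using elim s by (intro mult_left_mono) auto
      then show ?case using sv[of k] s(1)[of k] \<open>0 < L\<close> by (simp add: field_simps)
    qed
    ultimately have "summable s" by (rule summable_comparison_test_ev[rotated])
    then show False using s by simp
  qed
  ultimately show ?thesis using vL by simp
qed

lemma weight_sum_eq: "weight_sum \<gamma> r k = (\<Sum>j\<le>k. \<gamma> j powr r)"
  by (induction k) auto

lemma weighted_avg_eq:
  assumes "\<And>k. 0 < \<gamma> k"
  shows "weighted_avg \<gamma> r x k = (\<Sum>j\<le>k. \<gamma> j powr r *\<^sub>R x j) /\<^sub>R weight_sum \<gamma> r k"
proof (induction k)
  case 0
  then show ?case using assms[of 0] by simp
next
  case (Suc k)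
  have "weight_sum \<gamma> r k > 0"
    unfolding weight_sum_eq by (intro sum_pos) (use assms in \<open>auto simp: less_imp_neq[symmetric]\<close>)
  then show ?case by (simp add: Suc.IH)
qed

text \<open>Toeplitz argument: the total weight \<open>W\<close> diverges, so the fixed contribution
  \<open>C\<close> of the finitely many early terms is washed out, while the later terms average
  values below \<open>e / 2\<close>.\<close>

lemma weighted_mean_tendsto_zero:
  fixes u w :: "nat \<Rightarrow> real"
  assumes u: "u \<longlonglongrightarrow> 0" and w: "\<And>k. 0 < w k" "\<not> summable w"
  shows "(\<lambda>k. (\<Sum>j\<le>k. w j * u j) / (\<Sum>j\<le>k. w j)) \<longlonglongrightarrow> 0"
proof (rule LIMSEQ_I)
  fix e :: real assume e: "0 < e"
  define W where "W k = (\<Sum>j\<le>k. w j)" for k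
  have Wpos: "0 < W k" for k unfolding W_def using w by (intro sum_pos) auto
  have W_top: "filterlim W at_top sequentially"
  proof -
    have "incseq W" unfolding W_def incseq_Suc_iff using w by (simp add: less_imp_le)
    moreover have "\<not> bdd_above (range W)"
    proof
      assume "bdd_above (range W)"
      then obtain B where B: "\<And>k. W k \<le> B" by (auto simp: bdd_above_def)
      have "sum w {..<n} \<le> B" for n
        using B[of n] sum_mono2[of "{..n}" "{..<n}" w] w unfolding W_def
        by (smt (verit) finite_atMost lessThan_subset_iff lessThan_Suc_atMost le_SucI order_refl)
      then show False using w
        by (metis less_imp_le bounded_imp_summable lessThan_Suc_atMost)
    qed
    ultimately have "\<exists>k0. \<forall>k\<ge>k0. B \<le> W k" for B
      unfolding bdd_above_def incseq_def by (metis linorder_le_cases order_trans rangeE)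
    then show ?thesis by (simp add: filterlim_at_top eventually_sequentially)
  qed
  obtain N where N: "\<And>k. k \<ge> N \<Longrightarrow> \<bar>u k\<bar> < e / 2"
    using LIMSEQ_D[OF u, of "e / 2"] e by auto
  define C where "C = (\<Sum>j<N. w j * \<bar>u j\<bar>)"
  have "\<forall>\<^sub>F k in sequentially. 2 * C / e < W k"
    using W_top by (simp add: filterlim_at_top_dense)
  then obtain N' where N': "\<And>k. k \<ge> N' \<Longrightarrow> 2 * C / e < W k"
    by (auto simp: eventually_sequentially)
  show "\<exists>no. \<forall>n\<ge>no. norm ((\<Sum>j\<le>n. w j * u j) / (\<Sum>j\<le>n. w j) - 0) < e"
  proof (intro exI allI impI)
    fix n assume n: "n \<ge> max N N'"
    have "\<bar>\<Sum>j\<le>n. w j * u j\<bar> \<le> (\<Sum>j\<le>n. w j * \<bar>u j\<bar>)"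
      using sum_abs[of "\<lambda>j. w j * u j" "{..n}"] w by (simp add: abs_mult less_imp_le)
    \<comment> \<open>Indices below \<open>N\<close> are granted \<open>e / 2\<close> as well, so
      that the second summand adds up to \<open>W n * (e / 2)\<close> over the full range.\<close>
    also have "\<dots> \<le> (\<Sum>j\<le>n. (if j < N then w j * \<bar>u j\<bar> else 0) + w j * (e / 2))"
      using N w(1) e by (intro sum_mono) (auto simp: less_imp_le not_less intro!: mult_left_mono)
    also have "\<dots> = (\<Sum>j\<in>{..n} \<inter> {..<N}. w j * \<bar>u j\<bar>) + W n * (e / 2)"
      unfolding W_def sum.distrib sum_distrib_right by (simp add: sum.inter_restrict lessThan_def)
    also have "{..n} \<inter> {..<N} = {..<N}" using n by auto
    also have "(\<Sum>j\<in>{..<N}. w j * \<bar>u j\<bar>) < W n * (e / 2)"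
      using N'[of n] n e unfolding C_def[symmetric] by (simp add: field_simps)
    finally have "\<bar>\<Sum>j\<le>n. w j * u j\<bar> < W n * e" by (simp add: mult.commute)
    then show "norm ((\<Sum>j\<le>n. w j * u j) / (\<Sum>j\<le>n. w j) - 0) < e"
      using Wpos[of n] unfolding W_def[symmetric] by (simp add: field_simps)
  qed
qed

lemma summable_add1_powr_iff: "summable (\<lambda>k. (real k + 1) powr p) \<longleftrightarrow> p < - 1"
  using summable_Suc_iff[of "\<lambda>n. real n powr p"] by (simp add: summable_real_powr_iff add.commute)

text \<open>Convexity of the norm, with the normalised weights as coefficients. Both the pathwise
  limit and the limit in mean are read off from this majorant.\<close>

lemma norm_weighted_avg_diff_le:
  fixes x :: "nat \<Rightarrow> 'a::real_normed_vector"
  assumes "\<And>k. 0 < \<gamma> k"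
  shows "norm (weighted_avg \<gamma> r x k - z) \<le> (\<Sum>j\<le>k. \<gamma> j powr r * norm (x j - z)) / (\<Sum>j\<le>k. \<gamma> j powr r)"
proof -
  define S where "S = (\<Sum>j\<le>k. \<gamma> j powr r)"
  have S: "0 < S" unfolding S_def by (intro sum_pos) (use assms in \<open>auto simp: less_imp_neq[symmetric]\<close>)
  have "weighted_avg \<gamma> r x k - z = (\<Sum>j\<le>k. \<gamma> j powr r *\<^sub>R (x j - z)) /\<^sub>R S"
    using S weighted_avg_eq[OF assms, where r = r and x = x and k = k]
    by (simp add: weight_sum_eq S_def[symmetric] scaleR_right_diff_distrib sum_subtractf scaleR_left.sum[symmetric])
  then have "norm (weighted_avg \<gamma> r x k - z) = norm (\<Sum>j\<le>k. \<gamma> j powr r *\<^sub>R (x j - z)) / S"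
    using S by (simp add: divide_inverse mult.commute)
  also have "\<dots> \<le> (\<Sum>j\<le>k. norm (\<gamma> j powr r *\<^sub>R (x j - z))) / S"
    using S by (intro divide_right_mono norm_sum) auto
  finally show ?thesis by (simp add: S_def)
qed

lemma weighted_avg_tendsto:
  fixes x :: "nat \<Rightarrow> 'a::real_normed_vector"
  assumes "\<And>k. 0 < \<gamma> k" "\<not> summable (\<lambda>k. \<gamma> k powr r)" "x \<longlonglongrightarrow> z"
  shows "weighted_avg \<gamma> r x \<longlonglongrightarrow> z"
proof -
  have "(\<lambda>k. norm (x k - z)) \<longlonglongrightarrow> 0"
    using assms(3) by (simp add: LIM_zero tendsto_norm_zero)
  then have "(\<lambda>k. (\<Sum>j\<le>k. \<gamma> j powr r * norm (x j - z)) / (\<Sum>j\<le>k. \<gamma> j powr r)) \<longlonglongrightarrow> 0"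
    using assms by (intro weighted_mean_tendsto_zero) (auto simp: less_imp_neq[symmetric])
  then have "(\<lambda>k. weighted_avg \<gamma> r x k - z) \<longlonglongrightarrow> 0"
    by (rule Lim_null_comparison[rotated]) (intro always_eventually allI norm_weighted_avg_diff_le assms)
  then show ?thesis by (simp add: LIM_zero_iff)
qed

section \<open>Almost supermartingales\<close>

text \<open>Doob's maximal inequality with an additive error, proved by stopping at the first
  passage above \<open>\<epsilon>\<close>. Integrals over the events of \<open>Fk k\<close> stand in
  for conditional expectations.\<close>

lemma (in prob_space) almost_supermartingale_maximal:
  fixes Z :: "nat \<Rightarrow> 'a \<Rightarrow> real" and Fk :: "nat \<Rightarrow> 'a measure" and \<theta> :: "nat \<Rightarrow> real"
  assumes sub: "\<And>k. subalgebra M (Fk k)"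
    and mono: "\<And>j k. j \<le> k \<Longrightarrow> sets (Fk j) \<subseteq> sets (Fk k)"
    and meas: "\<And>k. Z k \<in> borel_measurable (Fk k)"
    and nonneg: "\<And>k \<omega>. \<omega> \<in> space M \<Longrightarrow> 0 \<le> Z k \<omega>"
    and int: "\<And>k. integrable M (Z k)"
    and step: "\<And>k A. m \<le> k \<Longrightarrow> A \<in> sets (Fk k) \<Longrightarrow>
      (LINT \<omega>:A|M. Z (Suc k) \<omega>) \<le> (LINT \<omega>:A|M. Z k \<omega>) + \<theta> k"
    and \<epsilon>: "0 \<le> \<epsilon>"
  shows "\<epsilon> * prob {\<omega>\<in>space M. \<exists>k\<in>{m..<m+n}. \<epsilon> \<le> Z k \<omega>} \<le> expectation (Z m) + (\<Sum>j<n. \<theta> (m + j))"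
proof -
  have space [simp]: "space (Fk k) = space M" for k
    using sub[of k] by (simp add: subalgebra_def)
  define B where "B n = {\<omega>\<in>space M. \<forall>k\<in>{m..<m+n}. Z k \<omega> < \<epsilon>}" for n
  have Zless: "{\<omega>\<in>space M. Z j \<omega> < \<epsilon>} \<in> sets (Fk k)" if "j \<le> k" for j k
  proof -
    have "{\<omega>\<in>space (Fk j). Z j \<omega> < \<epsilon>} \<in> sets (Fk j)"
      using meas[of j] by measurable
    then show ?thesis using mono[OF that] by auto
  qed
  have B_Suc: "B (Suc n) = B n \<inter> {\<omega>\<in>space M. Z (m + n) \<omega> < \<epsilon>}" for n
    by (auto simp: B_def less_Suc_eq)
  \<comment> \<open>\<open>B n\<close> involves \<open>Z\<close> only at times strictly before
    \<open>m + n\<close>. Hence \<open>B (Suc n)\<close> already belongs to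
    \<open>Fk (m + n)\<close>, as \<open>step\<close> requires.\<close>
  have B_sets': "B n \<in> sets (Fk k)" if "m + n \<le> Suc k" for n k
    using that
  proof (induction n)
    case 0
    have "B 0 = space (Fk k)" by (auto simp: B_def)
    then show ?case using sets.top[of "Fk k"] by simp
  next
    case (Suc n)
    then show ?case unfolding B_Suc by (intro sets.Int Zless) auto
  qed
  have [measurable]: "A \<in> events" if "A \<in> sets (Fk k)" for A k
    using that sub[of k] by (auto simp: subalgebra_def)
  have B_ev [measurable]: "B n \<in> events" for n
    using B_sets'[of n "m + n"] by measurable
  have si: "set_integrable M A (Z k)" if "A \<in> events" for A k
    unfolding set_integrable_def by (intro integrable_mult_indicator that int)
  \<comment> \<open>Invariant of the stopped process: the probability of having passed the level,
    valued at \<open>\<epsilon>\<close>, plus the mass of \<open>Z\<close> still running on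
    \<open>B n\<close>.\<close>
  have key: "\<epsilon> * prob (space M - B n) + (LINT \<omega>:B n|M. Z (m + n) \<omega>)
      \<le> expectation (Z m) + (\<Sum>j<n. \<theta> (m + j))" for n
  proof (induction n)
    case 0
    have "B 0 = space M" by (auto simp: B_def)
    then show ?case by (simp add: set_integral_space int)
  next
    case (Suc n)
    have sub': "B (Suc n) \<subseteq> B n" unfolding B_Suc by auto
    have "B n \<subseteq> space M" by (auto simp: B_def)
    have "(LINT \<omega>:B (Suc n)|M. Z (m + Suc n) \<omega>) \<le> (LINT \<omega>:B (Suc n)|M. Z (m + n) \<omega>) + \<theta> (m + n)"
      using step[of "m + n" "B (Suc n)"] B_sets'[of "Suc n" "m + n"] by simp
    moreover have "(LINT \<omega>:B n|M. Z (m + n) \<omega>) =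
        (LINT \<omega>:B (Suc n)|M. Z (m + n) \<omega>) + (LINT \<omega>:B n - B (Suc n)|M. Z (m + n) \<omega>)"
      using sub' set_integral_Un[of "B (Suc n)" "B n - B (Suc n)" M "Z (m + n)"]
      by (simp add: si Un_absorb1)
    \<comment> \<open>Paths that leave at time \<open>m + n\<close> have just reached the level, so
      their share of the integral pays for the added probability.\<close>
    moreover have "\<epsilon> * prob (B n - B (Suc n)) \<le> (LINT \<omega>:B n - B (Suc n)|M. Z (m + n) \<omega>)"
    proof -
      have "(LINT \<omega>:B n - B (Suc n)|M. \<epsilon>) \<le> (LINT \<omega>:B n - B (Suc n)|M. Z (m + n) \<omega>)"
      proof (intro set_integral_mono si)
        show "set_integrable M (B n - B (Suc n)) (\<lambda>_. \<epsilon>)"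
          unfolding set_integrable_def by (intro integrable_mult_indicator) auto
        show "\<epsilon> \<le> Z (m + n) \<omega>" if "\<omega> \<in> B n - B (Suc n)" for \<omega>
          using that \<open>B n \<subseteq> space M\<close> unfolding B_Suc by auto
      qed auto
      then show ?thesis by (simp add: set_lebesgue_integral_def mult.commute)
    qed
    moreover have "prob (space M - B (Suc n)) = prob (space M - B n) + prob (B n - B (Suc n))"
    proof -
      have "space M - B (Suc n) = (space M - B n) \<union> (B n - B (Suc n))"
        using sub' \<open>B n \<subseteq> space M\<close> by blast
      moreover have "prob ((space M - B n) \<union> (B n - B (Suc n))) = prob (space M - B n) + prob (B n - B (Suc n))"
        by (intro finite_measure_Union) auto
      ultimately show ?thesis by simp
    qed
    ultimately show ?case using Suc.IH by (simp add: algebra_simps)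
  qed
  have "0 \<le> (LINT \<omega>:B n|M. Z (m + n) \<omega>)"
    unfolding set_lebesgue_integral_def using nonneg by (intro integral_nonneg_AE) auto
  moreover have "space M - B n = {\<omega>\<in>space M. \<exists>k\<in>{m..<m+n}. \<epsilon> \<le> Z k \<omega>}"
    by (auto simp: B_def not_less)
  ultimately show ?thesis using key[of n] by simp
qed

text \<open>The maximal inequality is started at a late time \<open>m\<close>: the mean of
  \<open>Z m\<close> and the remaining errors \<open>T m\<close> both vanish as \<open>m\<close>
  grows, so for each level almost no path exceeds it infinitely often. Countably many levels
  suffice.\<close>

lemma (in prob_space) almost_supermartingale_AE_tendsto_zero:
  fixes Z :: "nat \<Rightarrow> 'a \<Rightarrow> real" and Fk :: "nat \<Rightarrow> 'a measure" and \<theta> :: "nat \<Rightarrow> real"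
  assumes sub: "\<And>k. subalgebra M (Fk k)"
    and mono: "\<And>j k. j \<le> k \<Longrightarrow> sets (Fk j) \<subseteq> sets (Fk k)"
    and meas: "\<And>k. Z k \<in> borel_measurable (Fk k)"
    and nonneg: "\<And>k \<omega>. \<omega> \<in> space M \<Longrightarrow> 0 \<le> Z k \<omega>"
    and int: "\<And>k. integrable M (Z k)"
    and \<theta>: "summable \<theta>" "\<And>k. 0 \<le> \<theta> k"
    and step: "\<And>k A. K \<le> k \<Longrightarrow> A \<in> sets (Fk k) \<Longrightarrow>
      (LINT \<omega>:A|M. Z (Suc k) \<omega>) \<le> (LINT \<omega>:A|M. Z k \<omega>) + \<theta> k"
    and lim: "(\<lambda>k. expectation (Z k)) \<longlonglongrightarrow> 0"
  shows "AE \<omega> in M. (\<lambda>k. Z k \<omega>) \<longlonglongrightarrow> 0"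
proof -
  define T where "T k = (\<Sum>j. \<theta> (j + k))" for k
  have T_lim: "T \<longlonglongrightarrow> 0"
    unfolding T_def using suminf_exist_split2[OF \<theta>(1)] .
  have [measurable]: "Z k \<in> borel_measurable M" for k
    using int by blast
  define N where "N \<epsilon> m = {\<omega>\<in>space M. \<exists>k\<ge>m. \<epsilon> \<le> Z k \<omega>}" for \<epsilon> m
  have N_sets [measurable]: "N \<epsilon> m \<in> events" for \<epsilon> m unfolding N_def by measurable
  have N_bound: "\<epsilon> * prob (N \<epsilon> m) \<le> expectation (Z m) + T m" if "0 < \<epsilon>" "K \<le> m" for \<epsilon> m
  proof -
    \<comment> \<open>Finite horizons increase to \<open>N \<epsilon> m\<close>; continuity of the
      measure from below transfers the bound.\<close>
    define C where "C n = {\<omega>\<in>space M. \<exists>k\<in>{m..<m+n}. \<epsilon> \<le> Z k \<omega>}" for n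
    have "C n \<in> events" for n unfolding C_def by measurable
    moreover have "incseq C" unfolding C_def incseq_def by fastforce
    ultimately have "(\<lambda>n. prob (C n)) \<longlonglongrightarrow> prob (\<Union>n. C n)"
      by (intro finite_Lim_measure_incseq) auto
    moreover have "(\<Union>n. C n) = N \<epsilon> m"
    proof (intro equalityI subsetI)
      fix \<omega> assume "\<omega> \<in> N \<epsilon> m"
      then obtain k where "\<omega> \<in> space M" "m \<le> k" "\<epsilon> \<le> Z k \<omega>" by (auto simp: N_def)
      then have "\<omega> \<in> C (Suc k)" by (auto simp: C_def)
      then show "\<omega> \<in> (\<Union>n. C n)" by blast
    qed (auto simp: C_def N_def)
    ultimately have "(\<lambda>n. \<epsilon> * prob (C n)) \<longlonglongrightarrow> \<epsilon> * prob (N \<epsilon> m)"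
      by (auto intro: tendsto_mult_left)
    moreover have "\<epsilon> * prob (C n) \<le> expectation (Z m) + T m" for n
    proof -
      have "\<epsilon> * prob (C n) \<le> expectation (Z m) + (\<Sum>j<n. \<theta> (m + j))"
        unfolding C_def using that step
        by (intro almost_supermartingale_maximal[OF sub mono meas nonneg int]) auto
      also have "(\<Sum>j<n. \<theta> (m + j)) \<le> T m"
        unfolding T_def add.commute[of m]
        by (intro sum_le_suminf summable_ignore_initial_segment \<theta>) auto
      finally show ?thesis by simp
    qed
    ultimately show ?thesis by (intro LIMSEQ_le_const2) auto
  qed
  have null: "prob (\<Inter>m. N \<epsilon> m) = 0" if "0 < \<epsilon>" for \<epsilon>
  proof -
    have le: "\<epsilon> * prob (\<Inter>m. N \<epsilon> m) \<le> expectation (Z m) + T m" if "K \<le> m" for m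
    proof -
      have "prob (\<Inter>m. N \<epsilon> m) \<le> prob (N \<epsilon> m)" by (intro finite_measure_mono) auto
      then have "\<epsilon> * prob (\<Inter>m. N \<epsilon> m) \<le> \<epsilon> * prob (N \<epsilon> m)" using \<open>0 < \<epsilon>\<close> by simp
      then show ?thesis using N_bound[OF \<open>0 < \<epsilon>\<close> that] by simp
    qed
    have "(\<lambda>m. expectation (Z m) + T m) \<longlonglongrightarrow> 0 + 0" using lim T_lim by (rule tendsto_add)
    then have "\<epsilon> * prob (\<Inter>m. N \<epsilon> m) \<le> 0"
      using le LIMSEQ_le_const[of "\<lambda>m. expectation (Z m) + T m" 0] by auto
    then show ?thesis using \<open>0 < \<epsilon>\<close> measure_nonneg[of M "\<Inter>m. N \<epsilon> m"]
      by (simp add: mult_le_0_iff order_antisym)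
  qed
  have "AE \<omega> in M. \<omega> \<notin> (\<Inter>m. N (1 / real (Suc n)) m)" for n
  proof (rule AE_not_in)
    show "(\<Inter>m. N (1 / real (Suc n)) m) \<in> null_sets M"
      using null[of "1 / real (Suc n)"] by (auto simp: null_sets_def emeasure_eq_measure)
  qed
  then have "AE \<omega> in M. \<forall>n. \<omega> \<notin> (\<Inter>m. N (1 / real (Suc n)) m)"
    by (simp add: AE_all_countable)
  then show ?thesis
    using AE_space
  proof eventually_elim
    case (elim \<omega>)
    show ?case
    proof (rule LIMSEQ_I)
      fix e :: real assume "0 < e"
      then obtain n where n: "1 / real (Suc n) < e" using nat_approx_posE by blast
      obtain m where "\<omega> \<notin> N (1 / real (Suc n)) m" using elim by blast
      then have "\<forall>k\<ge>m. Z k \<omega> < 1 / real (Suc n)"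
        using elim(2) unfolding N_def by force
      then show "\<exists>no. \<forall>k\<ge>no. norm (Z k \<omega> - 0) < e"
        using n nonneg[OF elim(2)] by (intro exI[of _ m]) (auto intro: order.strict_trans)
    qed
  qed
qed

section \<open>Histories and random indices\<close>

text \<open>The sigma-algebra of the past before the draw of \<open>ix k\<close>. It is the pullback
  along exactly the map that occurs in the independence hypothesis, and the restriction to
  \<open>{..<k}\<close> makes the second component an element of the product space.\<close>

definition history :: "'w measure \<Rightarrow> ('w \<Rightarrow> 'a::topological_space) \<Rightarrow> (nat \<Rightarrow> 'w \<Rightarrow> 'd) \<Rightarrow> nat \<Rightarrow> 'w measure" where
  "history M x0 ix k = vimage_algebra (space M) (\<lambda>\<omega>. (x0 \<omega>, \<lambda>j\<in>{..<k}. ix j \<omega>))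
     (borel \<Otimes>\<^sub>M PiM {..<k} (\<lambda>_. count_space UNIV))"

lemma space_history [simp]: "space (history M x0 ix k) = space M"
  by (simp add: history_def)

lemma history_map_space:
  "(\<lambda>\<omega>. (x0 \<omega>, \<lambda>j\<in>{..<k}. ix j \<omega>)) \<in> space M \<rightarrow> space (borel \<Otimes>\<^sub>M PiM {..<k} (\<lambda>_. count_space UNIV))"
  by (auto simp: space_pair_measure space_PiM)

lemma measurable_history_initial [measurable]: "x0 \<in> borel_measurable (history M x0 ix k)"
  using measurable_compose[OF measurable_vimage_algebra1[OF history_map_space] measurable_fst]
  by (simp add: history_def)

lemma measurable_history_index:
  assumes "j < k"
  shows "ix j \<in> measurable (history M x0 ix k) (count_space UNIV)"
proof -
  have "(\<lambda>\<omega>. (\<lambda>j\<in>{..<k}. ix j \<omega>) j) \<in> measurable (history M x0 ix k) (count_space UNIV)"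
    using measurable_compose[OF measurable_compose[OF measurable_vimage_algebra1[OF history_map_space] measurable_snd]
        measurable_component_singleton[of j "{..<k}" "\<lambda>_. count_space UNIV"]] assms
    by (simp add: history_def)
  then show ?thesis using assms by simp
qed

lemma sets_history_mono:
  assumes "j \<le> k"
  shows "sets (history M x0 ix j) \<subseteq> sets (history M x0 ix k)"
  unfolding history_def[of M x0 ix j]
proof (rule sets_image_in_sets)
  show "(\<lambda>\<omega>. (x0 \<omega>, \<lambda>j\<in>{..<j}. ix j \<omega>))
      \<in> measurable (history M x0 ix k) (borel \<Otimes>\<^sub>M PiM {..<j} (\<lambda>_. count_space UNIV))"
    using assms by (intro measurable_Pair measurable_history_initial measurable_restrict measurable_history_index) auto
qed simp

lemma subalgebra_history:
  assumes "(\<lambda>\<omega>. (x0 \<omega>, \<lambda>j\<in>{..<k}. ix j \<omega>)) \<in> measurable M (borel \<Otimes>\<^sub>M PiM {..<k} (\<lambda>_. count_space UNIV))"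
  shows "subalgebra M (history M x0 ix k)"
  using sets_image_in_sets[OF refl assms] by (simp add: subalgebra_def history_def)

text \<open>Every event of the history is a preimage under the pair map, so independence of that map
  from \<open>ix k\<close> gives the product rule, and uniformity supplies the factor.\<close>

lemma (in prob_space) prob_history_index:
  fixes ix :: "nat \<Rightarrow> 'a \<Rightarrow> 'd::finite"
  assumes indep: "indep_rv M (borel \<Otimes>\<^sub>M PiM {..<k} (\<lambda>_. count_space UNIV)) (\<lambda>\<omega>. (x0 \<omega>, \<lambda>j\<in>{..<k}. ix j \<omega>))
          (count_space UNIV) (ix k)"
    and unif: "distr M (count_space UNIV) (ix k) = uniform_count_measure UNIV"
    and A: "A \<in> sets (history M x0 ix k)"
  shows "prob (A \<inter> {\<omega>\<in>space M. ix k \<omega> = i}) = prob A / real CARD('d)"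
proof -
  have m [measurable]: "ix k \<in> measurable M (count_space UNIV)" using indep by (simp add: indep_rv_def)
  have "prob {\<omega>\<in>space M. ix k \<omega> = i} = measure (distr M (count_space UNIV) (ix k)) {i}"
    by (subst measure_distr) (auto intro!: arg_cong[where f=prob])
  also have "\<dots> = 1 / real CARD('d)"
    unfolding unif by (simp add: measure_uniform_count_measure)
  finally have 1: "prob {\<omega>\<in>space M. ix k \<omega> = i} = 1 / real CARD('d)" .
  have "prob (A \<inter> {\<omega>\<in>space M. ix k \<omega> = i}) = prob A * prob {\<omega>\<in>space M. ix k \<omega> = i}"
  proof (rule indep_setD)
    show "indep_set {(\<lambda>\<omega>. (x0 \<omega>, \<lambda>j\<in>{..<k}. ix j \<omega>)) -` A \<inter> space M | A. A \<in> sets (borel \<Otimes>\<^sub>M PiM {..<k} (\<lambda>_. count_space UNIV))}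
       {ix k -` B \<inter> space M | B. B \<in> sets (count_space UNIV)}"
      using indep unfolding indep_rv_def by blast
    show "A \<in> {(\<lambda>\<omega>. (x0 \<omega>, \<lambda>j\<in>{..<k}. ix j \<omega>)) -` A \<inter> space M | A. A \<in> sets (borel \<Otimes>\<^sub>M PiM {..<k} (\<lambda>_. count_space UNIV))}"
      using A unfolding history_def sets_vimage_algebra2[OF history_map_space] .
    show "{\<omega>\<in>space M. ix k \<omega> = i} \<in> {ix k -` B \<inter> space M | B. B \<in> sets (count_space UNIV)}"
      by (auto intro!: exI[of _ "{i}"])
  qed
  then show ?thesis using 1 by simp
qed

text \<open>The hypothesis on single events of \<open>G\<close> is upgraded to independence of
  \<open>h\<close> and the indicator of \<open>E\<close> as random variables; then expectations of
  products factor.\<close>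

lemma (in prob_space) expectation_times_indep_event:
  fixes h :: "'a \<Rightarrow> real"
  assumes sub: "subalgebra M G" and h: "h \<in> borel_measurable G" "integrable M h"
    and E: "E \<in> events" and indep: "\<And>A. A \<in> sets G \<Longrightarrow> prob (A \<inter> E) = prob A * p"
  shows "expectation (\<lambda>\<omega>. h \<omega> * indicator E \<omega>) = expectation h * p"
proof -
  \<comment> \<open>The whole space as \<open>A\<close> identifies \<open>p\<close>.\<close>
  have p: "p = prob E"
    using indep[of "space M"] sub E sets.top[of G]
    by (simp add: subalgebra_def prob_space Int_absorb1 sets.sets_into_space)
  have G_events: "A \<in> events" if "A \<in> sets G" for A using that sub by (auto simp: subalgebra_def)
  have G_space: "space G = space M" using sub by (simp add: subalgebra_def)
  have "indep_var borel h borel (indicator E :: 'a \<Rightarrow> real)"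
    unfolding indep_var_eq
  proof (intro conjI)
    show hM: "h \<in> borel_measurable M" using h by blast
    show "(indicator E :: 'a \<Rightarrow> real) \<in> borel_measurable M" using E by simp
    have sub1: "sigma_sets (space M) {h -` A \<inter> space M | A. A \<in> sets borel} \<subseteq> sets G"
      unfolding G_space[symmetric] using h(1) by (intro sets.sigma_sets_subset) (auto intro: measurable_sets)
    \<comment> \<open>An indicator generates no events but these four, and independence from
      \<open>G\<close> passes to the complement of \<open>E\<close>.\<close>
    have sub2: "sigma_sets (space M) {(indicator E :: 'a \<Rightarrow> real) -` A \<inter> space M | A. A \<in> sets borel} \<subseteq> {{}, E, space M - E, space M}"
    proof
      fix B assume "B \<in> sigma_sets (space M) {(indicator E :: 'a \<Rightarrow> real) -` A \<inter> space M | A. A \<in> sets borel}"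
      then have "B \<in> {(indicator E :: 'a \<Rightarrow> real) -` A \<inter> space M | A. A \<in> sets borel}"
        using sets_vimage_algebra[of "space M" "indicator E :: 'a \<Rightarrow> real" borel]
          sets_vimage_algebra2[of "indicator E :: 'a \<Rightarrow> real" "space M" borel] by auto
      then obtain A where "B = (indicator E :: 'a \<Rightarrow> real) -` A \<inter> space M" by blast
      then have "B = (if 1 \<in> A then E \<inter> space M else {}) \<union> (if 0 \<in> A then space M - E else {})"
        by (auto simp: indicator_def of_bool_def split: if_splits)
      moreover have "E \<inter> space M = E" "E \<union> (space M - E) = space M"
        using sets.sets_into_space[OF E] by auto
      ultimately show "B \<in> {{}, E, space M - E, space M}" by simp
    qed
    have I: "indep_set (sets G) {{}, E, space M - E, space M}"
    proof (rule indep_setI)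
      fix A B assume A: "A \<in> sets G" and B: "B \<in> {{}, E, space M - E, space M}"
      have "A \<inter> space M = A" using A G_space sets.sets_into_space by blast
      moreover have "A \<inter> (space M - E) = A - (A \<inter> E)" using \<open>A \<inter> space M = A\<close> by blast
      moreover have "prob (A - (A \<inter> E)) = prob A - prob (A \<inter> E)"
        using G_events[OF A] E by (intro finite_measure_Diff) auto
      ultimately show "prob (A \<inter> B) = prob A * prob B"
        using B indep[OF A] p E by (auto simp: prob_space prob_compl algebra_simps)
    qed (use E G_events in auto)
    show "indep_set (sigma_sets (space M) {h -` A \<inter> space M | A. A \<in> sets borel})
       (sigma_sets (space M) {(indicator E :: 'a \<Rightarrow> real) -` A \<inter> space M | A. A \<in> sets borel})"
    proof (rule indep_setI)
      show "sigma_sets (space M) {h -` A \<inter> space M | A. A \<in> sets borel} \<subseteq> events"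
        using sub1 indep_setD_ev1[OF I] by (rule order_trans)
      show "sigma_sets (space M) {(indicator E :: 'a \<Rightarrow> real) -` A \<inter> space M | A. A \<in> sets borel} \<subseteq> events"
        using sub2 indep_setD_ev2[OF I] by (rule order_trans)
    qed (rule indep_setD[OF I subsetD[OF sub1] subsetD[OF sub2]])
  qed
  then have "expectation (\<lambda>\<omega>. h \<omega> * indicator E \<omega>) = expectation h * expectation (indicator E :: 'a \<Rightarrow> real)"
    using h E by (intro indep_var_lebesgue_integral) (auto simp: less_top[symmetric])
  then show ?thesis using p E by simp
qed

text \<open>Freezing argument: on the event \<open>I \<omega> = i\<close> the integrand is
  \<open>\<phi> i\<close>, which depends on the past alone, so each of the finitely many cases
  factors and their sum is the average over \<open>i\<close>.\<close>

lemma (in prob_space) expectation_random_index: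
  fixes \<phi> :: "'d::finite \<Rightarrow> 'a \<Rightarrow> real"
  assumes sub: "subalgebra M G" and I: "I \<in> measurable M (count_space UNIV)"
    and \<phi>: "\<And>i. \<phi> i \<in> borel_measurable G" "\<And>i. integrable M (\<phi> i)"
    and indep: "\<And>A i. A \<in> sets G \<Longrightarrow> prob (A \<inter> {\<omega>\<in>space M. I \<omega> = i}) = prob A / real CARD('d)"
  shows "integrable M (\<lambda>\<omega>. \<phi> (I \<omega>) \<omega>)"
    and "expectation (\<lambda>\<omega>. \<phi> (I \<omega>) \<omega>) = expectation (\<lambda>\<omega>. (\<Sum>i\<in>UNIV. \<phi> i \<omega>) / real CARD('d))"
proof -
  define E where "E i = {\<omega>\<in>space M. I \<omega> = i}" for i
  have E: "E i \<in> events" for i unfolding E_def using I by measurable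
  have eq: "\<phi> (I \<omega>) \<omega> = (\<Sum>i\<in>UNIV. \<phi> i \<omega> * indicator (E i) \<omega>)" if "\<omega> \<in> space M" for \<omega>
    using that by (simp add: E_def indicator_def if_distrib[of "\<lambda>x. _ * x"] cong: if_cong)
  have int: "integrable M (\<lambda>\<omega>. \<phi> i \<omega> * indicator (E i) \<omega>)" for i
    by (intro integrable_real_mult_indicator E \<phi>)
  show "integrable M (\<lambda>\<omega>. \<phi> (I \<omega>) \<omega>)"
    by (subst Bochner_Integration.integrable_cong[OF refl eq]) (assumption, intro Bochner_Integration.integrable_sum int)
  have "expectation (\<lambda>\<omega>. \<phi> (I \<omega>) \<omega>) = expectation (\<lambda>\<omega>. \<Sum>i\<in>UNIV. \<phi> i \<omega> * indicator (E i) \<omega>)"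
    by (rule Bochner_Integration.integral_cong[OF refl eq])
  also have "\<dots> = (\<Sum>i\<in>UNIV. expectation (\<lambda>\<omega>. \<phi> i \<omega> * indicator (E i) \<omega>))"
    by (intro Bochner_Integration.integral_sum int)
  also have "\<dots> = (\<Sum>i\<in>UNIV. expectation (\<phi> i) * (1 / real CARD('d)))"
    by (intro sum.cong expectation_times_indep_event[OF sub \<phi> E] refl) (simp add: E_def indep)
  also have "\<dots> = expectation (\<lambda>\<omega>. (\<Sum>i\<in>UNIV. \<phi> i \<omega>) / real CARD('d))"
    by (simp add: \<phi> sum_divide_distrib)
  finally show "expectation (\<lambda>\<omega>. \<phi> (I \<omega>) \<omega>) = expectation (\<lambda>\<omega>. (\<Sum>i\<in>UNIV. \<phi> i \<omega>) / real CARD('d))" .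
qed

text \<open>The probabilistic core, separated from the geometry of the algorithm. Since
  \<open>W\<close> is known at time \<open>0\<close>, multiplying by it commutes with conditioning
  on the past. \<open>crude\<close> holds at all times and secures integrability; \<open>rec\<close>
  holds from time \<open>K\<close> on and drives the decay.\<close>

lemma (in prob_space) random_index_recursion:
  fixes ix :: "nat \<Rightarrow> 'a \<Rightarrow> 'd::finite" and e :: "nat \<Rightarrow> 'a \<Rightarrow> real" and \<phi> :: "nat \<Rightarrow> 'd \<Rightarrow> 'a \<Rightarrow> real"
    and Fk :: "nat \<Rightarrow> 'a measure" and W :: "'a \<Rightarrow> real" and t \<theta> :: "nat \<Rightarrow> real"
  assumes sub: "\<And>k. subalgebra M (Fk k)"
    and mono: "\<And>j k. j \<le> k \<Longrightarrow> sets (Fk j) \<subseteq> sets (Fk k)"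
    and ix: "\<And>k. ix k \<in> measurable M (count_space UNIV)"
    and indep: "\<And>k A i. A \<in> sets (Fk k) \<Longrightarrow> prob (A \<inter> {\<omega>\<in>space M. ix k \<omega> = i}) = prob A / real CARD('d)"
    and e: "\<And>k. e k \<in> borel_measurable (Fk k)" "\<And>k \<omega>. \<omega> \<in> space M \<Longrightarrow> 0 \<le> e k \<omega>"
    and \<phi>: "\<And>k i. \<phi> k i \<in> borel_measurable (Fk k)" "\<And>k i \<omega>. \<omega> \<in> space M \<Longrightarrow> 0 \<le> \<phi> k i \<omega>"
    and step: "\<And>k \<omega>. \<omega> \<in> space M \<Longrightarrow> e (Suc k) \<omega> = \<phi> k (ix k \<omega>) \<omega>"
    and crude: "\<And>k i \<omega>. \<omega> \<in> space M \<Longrightarrow> \<phi> k i \<omega> \<le> c k * (e k \<omega> + 1)"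
    and rec: "\<And>k \<omega>. K \<le> k \<Longrightarrow> \<omega> \<in> space M \<Longrightarrow> (\<Sum>i\<in>UNIV. \<phi> k i \<omega>) / real CARD('d) \<le> (1 - t k) * e k \<omega> + \<theta> k"
    and t: "\<And>k. 0 \<le> t k" "\<not> summable t" and \<theta>: "\<And>k. 0 \<le> \<theta> k" "summable \<theta>"
    and W: "W \<in> borel_measurable (Fk 0)" "\<And>\<omega>. \<omega> \<in> space M \<Longrightarrow> 0 \<le> W \<omega>"
      "integrable M W" "integrable M (\<lambda>\<omega>. W \<omega> * e 0 \<omega>)"
  shows "integrable M (\<lambda>\<omega>. W \<omega> * e k \<omega>)"
    and "(\<lambda>k. expectation (\<lambda>\<omega>. W \<omega> * e k \<omega>)) \<longlonglongrightarrow> 0"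
    and "AE \<omega> in M. (\<lambda>k. W \<omega> * e k \<omega>) \<longlonglongrightarrow> 0"
proof -
  define d where "d = real CARD('d)"
  have d: "0 < d" by (simp add: d_def)
  define Z where "Z = (\<lambda>k \<omega>. W \<omega> * e k \<omega>)"
  have Fk_space: "space (Fk k) = space M" for k using sub[of k] by (simp add: subalgebra_def)
  have W_meas [measurable]: "W \<in> borel_measurable (Fk k)" for k
    using W(1) mono[of 0 k] unfolding measurable_def Fk_space by auto
  note [measurable] = e(1) \<phi>(1)
  have Z_meas: "Z k \<in> borel_measurable (Fk k)" for k unfolding Z_def by measurable
  have W\<phi>_meas: "(\<lambda>\<omega>. W \<omega> * \<phi> k i \<omega>) \<in> borel_measurable (Fk k)" for k i by measurable
  have meas_M: "f \<in> borel_measurable M" if "f \<in> borel_measurable (Fk k)" for f :: "'a \<Rightarrow> real" and k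
    using measurable_from_subalg[OF sub that] .
  \<comment> \<open>Integrability at time \<open>k\<close> passes to all candidate values at time
    \<open>k + 1\<close>, through the dominating function from \<open>crude\<close>.\<close>
  have W\<phi>_int: "integrable M (\<lambda>\<omega>. W \<omega> * \<phi> k i \<omega>)" if "integrable M (Z k)" for k i
  proof (rule Bochner_Integration.integrable_bound)
    show "integrable M (\<lambda>\<omega>. c k * (Z k \<omega> + W \<omega>))" using that W by auto
    show "AE \<omega> in M. norm (W \<omega> * \<phi> k i \<omega>) \<le> norm (c k * (Z k \<omega> + W \<omega>))"
    proof (rule AE_I2)
      fix \<omega> assume \<omega>: "\<omega> \<in> space M"
      have "W \<omega> * \<phi> k i \<omega> \<le> W \<omega> * (c k * (e k \<omega> + 1))"
        using crude[OF \<omega>] W(2)[OF \<omega>] by (intro mult_left_mono) auto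
      also have "\<dots> = c k * (Z k \<omega> + W \<omega>)" by (simp add: Z_def algebra_simps)
      finally show "norm (W \<omega> * \<phi> k i \<omega>) \<le> norm (c k * (Z k \<omega> + W \<omega>))"
        using W(2)[OF \<omega>] \<phi>(2)[OF \<omega>, of k i] by auto
    qed
  qed (rule meas_M[OF W\<phi>_meas])
  have Z_Suc: "Z (Suc k) \<omega> = W \<omega> * \<phi> k (ix k \<omega>) \<omega>" if "\<omega> \<in> space M" for k \<omega>
    using step[OF that] by (simp add: Z_def)
  have Z_int: "integrable M (Z k)" for k
  proof (induction k)
    case 0
    then show ?case using W(4) by (simp add: Z_def)
  next
    case (Suc k)
    have "integrable M (\<lambda>\<omega>. W \<omega> * \<phi> k (ix k \<omega>) \<omega>)"
      using expectation_random_index(1)[OF sub ix W\<phi>_meas W\<phi>_int[OF Suc] indep] .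
    moreover have "integrable M (Z (Suc k)) \<longleftrightarrow> integrable M (\<lambda>\<omega>. W \<omega> * \<phi> k (ix k \<omega>) \<omega>)"
      by (intro Bochner_Integration.integrable_cong) (auto simp: Z_Suc)
    ultimately show ?case by simp
  qed
  then show "integrable M (\<lambda>\<omega>. W \<omega> * e k \<omega>)" unfolding Z_def .
  have Z_nonneg: "0 \<le> Z k \<omega>" if "\<omega> \<in> space M" for k \<omega>
    using W(2)[OF that] e(2)[OF that] by (simp add: Z_def)
  \<comment> \<open>The conditional form of the recursion. The whole space as \<open>A\<close> gives
    the recursion of the means; general \<open>A\<close> gives the almost supermartingale property.
    The indicator of \<open>A\<close> is known at time \<open>k\<close> and is absorbed into the
    candidates.\<close>
  have Z_rec: "(LINT \<omega>:A|M. Z (Suc k) \<omega>) \<le> (1 - t k) * (LINT \<omega>:A|M. Z k \<omega>) + \<theta> k * expectation W"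
    if k: "K \<le> k" and A: "A \<in> sets (Fk k)" for k A
  proof -
    note [measurable] = A
    have AM: "A \<in> events" using A sub[of k] by (auto simp: subalgebra_def)
    have \<psi>_meas: "(\<lambda>\<omega>. indicator A \<omega> * (W \<omega> * \<phi> k i \<omega>)) \<in> borel_measurable (Fk k)" for i
      by measurable
    have \<psi>_int: "integrable M (\<lambda>\<omega>. indicator A \<omega> * (W \<omega> * \<phi> k i \<omega>))" for i
      using integrable_mult_indicator[OF AM W\<phi>_int[OF Z_int]] by simp
    have AZ_int: "integrable M (\<lambda>\<omega>. indicator A \<omega> * Z k \<omega>)" for k
      using integrable_mult_indicator[OF AM Z_int] by simp
    have "(LINT \<omega>:A|M. Z (Suc k) \<omega>) = expectation (\<lambda>\<omega>. indicator A \<omega> * (W \<omega> * \<phi> k (ix k \<omega>) \<omega>))"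
      unfolding set_lebesgue_integral_def
      by (intro Bochner_Integration.integral_cong) (auto simp: Z_Suc)
    also have "\<dots> = expectation (\<lambda>\<omega>. (\<Sum>i\<in>UNIV. indicator A \<omega> * (W \<omega> * \<phi> k i \<omega>)) / d)"
      unfolding d_def
      by (rule expectation_random_index(2)[OF sub ix \<psi>_meas \<psi>_int indep])
    also have "\<dots> \<le> expectation (\<lambda>\<omega>. (1 - t k) * (indicator A \<omega> * Z k \<omega>) + \<theta> k * W \<omega>)"
    proof (rule integral_mono)
      show "integrable M (\<lambda>\<omega>. (\<Sum>i\<in>UNIV. indicator A \<omega> * (W \<omega> * \<phi> k i \<omega>)) / d)"
        by (intro integrable_divide_zero Bochner_Integration.integrable_sum \<psi>_int)
      show "integrable M (\<lambda>\<omega>. (1 - t k) * (indicator A \<omega> * Z k \<omega>) + \<theta> k * W \<omega>)"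
        using AZ_int W by auto
      fix \<omega> assume \<omega>: "\<omega> \<in> space M"
      have "(\<Sum>i\<in>UNIV. indicator A \<omega> * (W \<omega> * \<phi> k i \<omega>)) / d
          = indicator A \<omega> * W \<omega> * ((\<Sum>i\<in>UNIV. \<phi> k i \<omega>) / d)"
        by (simp add: sum_distrib_left mult.assoc)
      also have "\<dots> \<le> indicator A \<omega> * W \<omega> * ((1 - t k) * e k \<omega> + \<theta> k)"
        using rec[OF k \<omega>] W(2)[OF \<omega>] unfolding d_def by (intro mult_left_mono) auto
      also have "\<dots> = (1 - t k) * (indicator A \<omega> * Z k \<omega>) + \<theta> k * W \<omega> * indicator A \<omega>"
        by (simp add: Z_def algebra_simps)
      \<comment> \<open>The indicator is dropped from the error term, so that the error
        \<open>\<theta> k * expectation W\<close> no longer depends on \<open>A\<close>.\<close>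
      also have "\<theta> k * W \<omega> * indicator A \<omega> \<le> \<theta> k * W \<omega> * 1"
        using W(2)[OF \<omega>] \<theta>(1)[of k] by (intro mult_left_mono) (auto simp: indicator_def)
      finally show "(\<Sum>i\<in>UNIV. indicator A \<omega> * (W \<omega> * \<phi> k i \<omega>)) / d
          \<le> (1 - t k) * (indicator A \<omega> * Z k \<omega>) + \<theta> k * W \<omega>" by simp
    qed
    also have "\<dots> = (1 - t k) * (LINT \<omega>:A|M. Z k \<omega>) + \<theta> k * expectation W"
      using AZ_int W by (simp add: set_lebesgue_integral_def)
    finally show ?thesis .
  qed
  have EW: "0 \<le> expectation W" using W by (intro integral_nonneg_AE) auto
  have EZ: "0 \<le> expectation (Z k)" for k using Z_nonneg by (intro integral_nonneg_AE) auto
  have "(\<lambda>k. expectation (Z (k + K))) \<longlonglongrightarrow> 0"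
  proof (rule recursion_tendsto_zero)
    show "\<not> summable (\<lambda>k. t (k + K))" using t by (simp add: summable_iff_shift)
    show "summable (\<lambda>k. \<theta> (k + K) * expectation W)"
      using \<theta> by (intro summable_mult2) (simp add: summable_iff_shift)
    show "expectation (Z (Suc k + K)) \<le> (1 - t (k + K)) * expectation (Z (k + K)) + \<theta> (k + K) * expectation W" for k
      using Z_rec[of "k + K" "space M"] sets.top[of "Fk (k + K)"] Fk_space
      by (simp add: set_integral_space Z_int)
  qed (use t \<theta> EW EZ in auto)
  then have lim: "(\<lambda>k. expectation (Z k)) \<longlonglongrightarrow> 0" by (rule LIMSEQ_offset)
  then show "(\<lambda>k. expectation (\<lambda>\<omega>. W \<omega> * e k \<omega>)) \<longlonglongrightarrow> 0" by (simp add: Z_def)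
  have "AE \<omega> in M. (\<lambda>k. Z k \<omega>) \<longlonglongrightarrow> 0"
  proof (rule almost_supermartingale_AE_tendsto_zero[OF sub mono Z_meas Z_nonneg Z_int _ _ _ lim])
    show "summable (\<lambda>k. \<theta> k * expectation W)" using \<theta> by (intro summable_mult2)
    show "0 \<le> \<theta> k * expectation W" for k using \<theta> EW by simp
    fix k A assume k: "K \<le> k" and A: "A \<in> sets (Fk k)"
    have "0 \<le> (LINT \<omega>:A|M. Z k \<omega>)"
      unfolding set_lebesgue_integral_def using Z_nonneg by (intro integral_nonneg_AE) auto
    then have "0 \<le> t k * (LINT \<omega>:A|M. Z k \<omega>)" using t by simp
    then show "(LINT \<omega>:A|M. Z (Suc k) \<omega>) \<le> (LINT \<omega>:A|M. Z k \<omega>) + \<theta> k * expectation W"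
      using Z_rec[OF k A] by (simp add: left_diff_distrib)
  qed
  then show "AE \<omega> in M. (\<lambda>k. W \<omega> * e k \<omega>) \<longlonglongrightarrow> 0" by (simp add: Z_def)
qed

text \<open>Cauchy-Schwarz in Young's form: \<open>n \<le> n\<^sup>2 / (2 * \<epsilon> * V) +
  \<epsilon> * V / 2\<close>. Weighted second moments thus control first moments as long as
  \<open>V\<close> is integrable.\<close>

lemma (in prob_space) expectation_tendsto_zero_weighted:
  fixes n :: "nat \<Rightarrow> 'a \<Rightarrow> real" and V :: "'a \<Rightarrow> real"
  assumes n: "\<And>k. n k \<in> borel_measurable M" "\<And>k \<omega>. 0 \<le> n k \<omega>"
    and V: "integrable M V" "\<And>\<omega>. 1 \<le> V \<omega>"
    and int: "\<And>k. integrable M (\<lambda>\<omega>. 1 / V \<omega> * (n k \<omega>)\<^sup>2)"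
    and lim: "(\<lambda>k. expectation (\<lambda>\<omega>. 1 / V \<omega> * (n k \<omega>)\<^sup>2)) \<longlonglongrightarrow> 0"
  shows "integrable M (n k)" and "(\<lambda>k. expectation (n k)) \<longlonglongrightarrow> 0"
proof -
  have amgm: "n k \<omega> \<le> 1 / V \<omega> * (n k \<omega>)\<^sup>2 / (2 * \<epsilon>) + \<epsilon> / 2 * V \<omega>" if "0 < \<epsilon>" for \<epsilon> k \<omega>
  proof -
    have V0: "0 < V \<omega>" using V(2)[of \<omega>] by linarith
    have "0 \<le> (n k \<omega> - \<epsilon> * V \<omega>)\<^sup>2 / (2 * \<epsilon> * V \<omega>)" using that V0 by simp
    also have "\<dots> = 1 / V \<omega> * (n k \<omega>)\<^sup>2 / (2 * \<epsilon>) + \<epsilon> / 2 * V \<omega> - n k \<omega>"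
      using that V0 by (simp add: power2_eq_square field_simps)
    finally show ?thesis by simp
  qed
  have bound_int: "integrable M (\<lambda>\<omega>. 1 / V \<omega> * (n k \<omega>)\<^sup>2 / (2 * \<epsilon>) + \<epsilon> / 2 * V \<omega>)" for \<epsilon> k
    using int[of k] V(1) by (intro Bochner_Integration.integrable_add integrable_mult_right integrable_divide_zero) auto
  show n_int: "integrable M (n k)" for k
  proof (rule Bochner_Integration.integrable_bound[OF bound_int[of k 1] n(1)])
    show "AE \<omega> in M. norm (n k \<omega>) \<le> norm (1 / V \<omega> * (n k \<omega>)\<^sup>2 / (2 * 1) + 1 / 2 * V \<omega>)"
    proof (rule AE_I2)
      fix \<omega>
      show "norm (n k \<omega>) \<le> norm (1 / V \<omega> * (n k \<omega>)\<^sup>2 / (2 * 1) + 1 / 2 * V \<omega>)"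
        using amgm[of 1 k \<omega>] n(2)[of k \<omega>] by simp
    qed
  qed
  have E: "expectation (n k) \<le> expectation (\<lambda>\<omega>. 1 / V \<omega> * (n k \<omega>)\<^sup>2) / (2 * \<epsilon>) + \<epsilon> / 2 * expectation V"
    if "0 < \<epsilon>" for \<epsilon> k
  proof -
    have "expectation (n k) \<le> expectation (\<lambda>\<omega>. 1 / V \<omega> * (n k \<omega>)\<^sup>2 / (2 * \<epsilon>) + \<epsilon> / 2 * V \<omega>)"
      by (intro integral_mono n_int bound_int amgm that)
    also have "\<dots> = expectation (\<lambda>\<omega>. 1 / V \<omega> * (n k \<omega>)\<^sup>2) / (2 * \<epsilon>) + \<epsilon> / 2 * expectation V"
    proof -
      have "expectation (\<lambda>\<omega>. P \<omega> / (2 * \<epsilon>) + \<epsilon> / 2 * V \<omega>) = expectation P / (2 * \<epsilon>) + \<epsilon> / 2 * expectation V"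
        if "integrable M P" for P :: "'a \<Rightarrow> real"
        using that V(1) by simp
      from this[OF int[of k]] show ?thesis .
    qed
    finally show ?thesis .
  qed
  have "1 \<le> expectation V"
    using integral_mono[OF _ V(1), of "\<lambda>_. 1"] V(2) by (simp add: prob_space)
  then have EV: "0 < expectation V" by linarith
  have En: "0 \<le> expectation (n k)" for k using n by (intro integral_nonneg_AE) auto
  show "(\<lambda>k. expectation (n k)) \<longlonglongrightarrow> 0"
  proof (rule LIMSEQ_I)
    fix \<delta> :: real assume \<delta>: "0 < \<delta>"
    \<comment> \<open>This choice makes the \<open>V\<close> term equal to
      \<open>\<delta> / 2\<close>; the other term falls below \<open>\<delta> / 2\<close> once the
      weighted second moment is less than \<open>\<epsilon> * \<delta>\<close>.\<close>
    define \<epsilon> where "\<epsilon> = \<delta> / expectation V"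
    have \<epsilon>: "0 < \<epsilon>" using \<delta> EV by (simp add: \<epsilon>_def)
    obtain N where N: "\<And>k. k \<ge> N \<Longrightarrow> \<bar>expectation (\<lambda>\<omega>. 1 / V \<omega> * (n k \<omega>)\<^sup>2)\<bar> < \<epsilon> * \<delta>"
      using LIMSEQ_D[OF lim, of "\<epsilon> * \<delta>"] \<epsilon> \<delta> by auto
    have "norm (expectation (n k) - 0) < \<delta>" if "k \<ge> N" for k
    proof -
      have "expectation (\<lambda>\<omega>. 1 / V \<omega> * (n k \<omega>)\<^sup>2) / (2 * \<epsilon>) < \<delta> / 2"
        using N[OF that] \<epsilon> by (simp add: field_simps)
      moreover have "\<epsilon> / 2 * expectation V = \<delta> / 2" using EV by (simp add: \<epsilon>_def)
      ultimately show ?thesis using E[OF \<epsilon>, of k] En[of k] by simp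
    qed
    then show "\<exists>N. \<forall>k\<ge>N. norm (expectation (n k) - 0) < \<delta>" by blast
  qed
qed

section \<open>Tikhonov regularization of variational inequalities\<close>

text \<open>Adding the two convexity inequalities with \<open>x\<close> and \<open>y\<close>
  exchanged cancels the values of \<open>f\<close>.\<close>

lemma strongly_convex_on_gradient_strongly_monotone:
  assumes "strongly_convex_on \<mu> X f g" "x \<in> X" "y \<in> X"
  shows "\<mu> * (norm (x - y))\<^sup>2 \<le> (g x - g y) \<bullet> (x - y)"
proof -
  have "f x \<ge> f y + g y \<bullet> (x - y) + \<mu> / 2 * (norm (x - y))\<^sup>2"
    and "f y \<ge> f x + g x \<bullet> (y - x) + \<mu> / 2 * (norm (y - x))\<^sup>2"
    using assms by (auto simp: strongly_convex_on_def)
  then show ?thesis by (simp add: norm_minus_commute algebra_simps)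
qed

text \<open>Hartman-Stampacchia: a fixed point of the projected step, which Brouwer's theorem
  provides, solves the variational inequality by the obtuse angle property of projections.\<close>

lemma SOL_nonempty_compact:
  fixes K :: "'a::euclidean_space set"
  assumes "compact K" "convex K" "K \<noteq> {}" "continuous_on K G"
  shows "SOL K G \<noteq> {}"
proof -
  have cl: "closed K" using assms by (simp add: compact_imp_closed)
  have "continuous_on K (\<lambda>x. closest_point K (x - G x))"
    using continuous_on_closest_point[OF \<open>convex K\<close> cl \<open>K \<noteq> {}\<close>, of UNIV]
    by (rule continuous_on_compose2) (auto intro!: continuous_on_diff continuous_on_id assms)
  moreover have "(\<lambda>x. closest_point K (x - G x)) \<in> K \<rightarrow> K"
    using cl assms by (auto intro: closest_point_in_set)
  ultimately obtain x where x: "x \<in> K" "closest_point K (x - G x) = x"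
    by (rule brouwer[OF assms(1-3)])
  have "G x \<bullet> (y - x) \<ge> 0" if "y \<in> K" for y
    using closest_point_dot[OF \<open>convex K\<close> cl that, of "x - G x"] x by simp
  then show ?thesis using x by (auto simp: SOL_def)
qed

text \<open>Testing the two inequalities at each other's solution and using monotonicity removes
  \<open>F\<close>, and \<open>\<eta>\<close> then cancels. The bound is uniform in
  \<open>\<eta>\<close> and refers to the set only through the solutions, so it also serves on
  truncations of \<open>X\<close>.\<close>

lemma Tikhonov_bound:
  fixes F g :: "'a::real_inner \<Rightarrow> 'a"
  assumes mono: "vi_monotone_on X F"
    and g: "\<And>x y. x \<in> X \<Longrightarrow> y \<in> X \<Longrightarrow> \<mu> * (norm (x - y))\<^sup>2 \<le> (g x - g y) \<bullet> (x - y)"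
    and pos: "0 < \<mu>" "0 < \<eta>"
    and y: "y \<in> SOL X (\<lambda>x. F x + \<eta> *\<^sub>R g x)" and z: "z \<in> SOL X F"
  shows "norm (y - z) \<le> norm (g z) / \<mu>"
proof -
  have yX: "y \<in> X" and zX: "z \<in> X" using y z by (auto simp: SOL_def)
  have "(F y + \<eta> *\<^sub>R g y) \<bullet> (z - y) \<ge> 0" "F z \<bullet> (y - z) \<ge> 0" "(F y - F z) \<bullet> (y - z) \<ge> 0"
    using y z mono by (auto simp: SOL_def vi_monotone_on_def)
  then have "0 \<le> \<eta> * (g y \<bullet> (z - y))"
    by (simp add: algebra_simps)
  then have "0 \<le> g y \<bullet> (z - y)" using pos by (simp add: zero_le_mult_iff)
  then have "\<mu> * (norm (y - z))\<^sup>2 \<le> g z \<bullet> (z - y)"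
    using g[OF yX zX] by (simp add: algebra_simps)
  also have "\<dots> \<le> norm (g z) * norm (y - z)"
    using norm_cauchy_schwarz[of "g z" "z - y"] by (simp add: norm_minus_commute)
  finally have "norm (y - z) * (\<mu> * norm (y - z)) \<le> norm (y - z) * norm (g z)"
    by (simp add: power2_eq_square algebra_simps)
  then have "y = z \<or> \<mu> * norm (y - z) \<le> norm (g z)"
    by (auto simp: mult_le_cancel_left)
  then show ?thesis using pos by (auto simp: field_simps)
qed

text \<open>\<open>X\<close> may be unbounded, so the inequality is first solved on the intersection
  with a ball around a solution \<open>z\<close> of the unregularized problem.\<close>

lemma Tikhonov_exists:
  fixes F g :: "'a::euclidean_space \<Rightarrow> 'a"
  assumes X: "closed X" "convex X" and cont: "continuous_on X F" "continuous_on X g"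
    and mono: "vi_monotone_on X F"
    and g: "\<And>x y. x \<in> X \<Longrightarrow> y \<in> X \<Longrightarrow> \<mu> * (norm (x - y))\<^sup>2 \<le> (g x - g y) \<bullet> (x - y)"
    and pos: "0 < \<mu>" "0 < \<eta>"
    and SOL: "SOL X F \<noteq> {}"
  shows "SOL X (\<lambda>x. F x + \<eta> *\<^sub>R g x) \<noteq> {}"
proof -
  define G where "G x = F x + \<eta> *\<^sub>R g x" for x
  obtain z where z: "z \<in> SOL X F" using SOL by blast
  \<comment> \<open>One more than the a priori bound, so that the solution on the ball keeps
    distance at least \<open>1\<close> from the sphere.\<close>
  define R where "R = norm (g z) / \<mu> + 1"
  define K where "K = X \<inter> cball z R"
  have KX: "K \<subseteq> X" by (auto simp: K_def)
  have "0 \<le> R" using pos by (simp add: R_def)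
  then have zK: "z \<in> K" using z by (simp add: K_def SOL_def)
  have contG: "continuous_on K G"
    unfolding G_def by (intro continuous_intros continuous_on_subset[OF _ KX] cont)
  have "SOL K G \<noteq> {}"
  proof (rule SOL_nonempty_compact)
    show "compact K" unfolding K_def using X by (simp add: closed_Int_compact)
    show "convex K" unfolding K_def using X by (simp add: convex_Int)
  qed (use zK contG in auto)
  then obtain y where y: "y \<in> SOL K G" by blast
  have zSK: "z \<in> SOL K F" using z zK KX by (auto simp: SOL_def)
  have "norm (y - z) \<le> norm (g z) / \<mu>"
  proof (rule Tikhonov_bound[OF _ _ pos _ zSK])
    show "vi_monotone_on K F" using mono KX unfolding vi_monotone_on_def by blast
    show "y \<in> SOL K (\<lambda>x. F x + \<eta> *\<^sub>R g x)" using y unfolding G_def .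
  qed (use g KX in blast)
  \<comment> \<open>The a priori bound holds on the truncated set as well, so \<open>y\<close> avoids the sphere and solves the
    untruncated inequality.\<close>
  then have slack: "norm (y - z) + 1 \<le> R" by (simp add: R_def)
  have yX: "y \<in> X" using y KX by (auto simp: SOL_def)
  have "G y \<bullet> (w - y) \<ge> 0" if w: "w \<in> X" for w
  proof -
    \<comment> \<open>The step towards \<open>w\<close> is shortened to length at most
      \<open>1\<close>, which is the slack available inside the ball.\<close>
    define t where "t = 1 / (1 + norm (w - y))"
    have t: "0 < t" "t \<le> 1" "t * norm (w - y) \<le> 1"
      by (auto simp: t_def add_nonneg_pos add_pos_nonneg divide_simps)
    define v where "v = y + t *\<^sub>R (w - y)"
    have "v = (1 - t) *\<^sub>R y + t *\<^sub>R w" by (simp add: v_def algebra_simps)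
    then have "v \<in> X" using convexD_alt[OF X(2) yX w, of t] t by simp
    moreover have "norm (v - z) \<le> R"
    proof -
      have "norm (v - z) \<le> norm (y - z) + norm (t *\<^sub>R (w - y))"
        unfolding v_def by (metis norm_triangle_ineq diff_add_eq)
      then show ?thesis using t slack by simp
    qed
    ultimately have "v \<in> K" by (simp add: K_def dist_norm norm_minus_commute)
    then have "G y \<bullet> (v - y) \<ge> 0" using y by (simp add: SOL_def)
    then show ?thesis using t by (simp add: v_def zero_le_mult_iff)
  qed
  then show ?thesis using yX by (auto simp: SOL_def G_def)
qed

text \<open>The same cross-testing for two regularization parameters: the surviving term is the
  difference of the parameters times the gradient at \<open>y1\<close>, set against the strong
  monotonicity of the second problem.\<close>

lemma Tikhonov_lipschitz:
  fixes F g :: "'a::real_inner \<Rightarrow> 'a"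
  assumes mono: "vi_monotone_on X F"
    and g: "\<And>x y. x \<in> X \<Longrightarrow> y \<in> X \<Longrightarrow> \<mu> * (norm (x - y))\<^sup>2 \<le> (g x - g y) \<bullet> (x - y)"
    and pos: "0 < \<eta>2"
    and y1: "y1 \<in> SOL X (\<lambda>x. F x + \<eta>1 *\<^sub>R g x)" and y2: "y2 \<in> SOL X (\<lambda>x. F x + \<eta>2 *\<^sub>R g x)"
  shows "\<eta>2 * \<mu> * norm (y1 - y2) \<le> \<bar>\<eta>1 - \<eta>2\<bar> * norm (g y1)"
proof -
  have X: "y1 \<in> X" "y2 \<in> X" using y1 y2 by (auto simp: SOL_def)
  have "(F y1 + \<eta>1 *\<^sub>R g y1) \<bullet> (y2 - y1) \<ge> 0" "(F y2 + \<eta>2 *\<^sub>R g y2) \<bullet> (y1 - y2) \<ge> 0"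
    "(F y1 - F y2) \<bullet> (y1 - y2) \<ge> 0"
    using y1 y2 mono by (auto simp: SOL_def vi_monotone_on_def)
  then have "\<eta>2 * ((g y1 - g y2) \<bullet> (y1 - y2)) \<le> (\<eta>1 - \<eta>2) * (g y1 \<bullet> (y2 - y1))"
    by (simp add: algebra_simps)
  also have "\<dots> \<le> \<bar>\<eta>1 - \<eta>2\<bar> * (norm (g y1) * norm (y1 - y2))"
  proof -
    have "(\<eta>1 - \<eta>2) * (g y1 \<bullet> (y2 - y1)) \<le> \<bar>\<eta>1 - \<eta>2\<bar> * \<bar>g y1 \<bullet> (y2 - y1)\<bar>"
      by (metis abs_ge_self abs_mult)
    also have "\<dots> \<le> \<bar>\<eta>1 - \<eta>2\<bar> * (norm (g y1) * norm (y1 - y2))"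
      using Cauchy_Schwarz_ineq2[of "g y1" "y2 - y1"]
      by (intro mult_left_mono) (auto simp: norm_minus_commute)
    finally show ?thesis .
  qed
  finally have "\<eta>2 * ((g y1 - g y2) \<bullet> (y1 - y2)) \<le> \<bar>\<eta>1 - \<eta>2\<bar> * (norm (g y1) * norm (y1 - y2))" .
  moreover have "\<eta>2 * (\<mu> * (norm (y1 - y2))\<^sup>2) \<le> \<eta>2 * ((g y1 - g y2) \<bullet> (y1 - y2))"
    using g[OF X] pos by simp
  ultimately have "norm (y1 - y2) * (\<eta>2 * \<mu> * norm (y1 - y2))
      \<le> norm (y1 - y2) * (\<bar>\<eta>1 - \<eta>2\<bar> * norm (g y1))"
    by (simp add: power2_eq_square algebra_simps)
  then have "y1 = y2 \<or> ?thesis"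
    by (auto simp: mult_le_cancel_left)
  then show ?thesis by auto
qed

text \<open>Compactness argument: the trajectory is bounded, every cluster point solves the
  inequality for \<open>F\<close> and minimizes \<open>f\<close> with quadratic growth, so there is
  only one cluster point and the whole sequence converges to it.\<close>

lemma Tikhonov_limit:
  fixes F g :: "'a::euclidean_space \<Rightarrow> 'a" and y :: "nat \<Rightarrow> 'a"
  assumes X: "closed X" and cont: "continuous_on X F" "continuous_on X g" "continuous_on X f"
    and mono: "vi_monotone_on X F"
    and sc: "0 < \<mu>" "strongly_convex_on \<mu> X f g"
    and \<eta>: "\<And>k. 0 < \<eta> k" "\<eta> \<longlonglongrightarrow> 0"
    and SOL: "SOL X F \<noteq> {}"
    and y: "\<And>k. y k \<in> SOL X (\<lambda>x. F x + \<eta> k *\<^sub>R g x)"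
  shows "y \<longlonglongrightarrow> arg_min_on f (SOL X F)"
proof -
  have yX: "y k \<in> X" for k using y[of k] by (simp add: SOL_def)
  obtain z where z: "z \<in> SOL X F" using SOL by blast
  have "norm (y k - z) \<le> norm (g z) / \<mu>" for k
    using Tikhonov_bound[OF mono strongly_convex_on_gradient_strongly_monotone[OF sc(2)] sc(1) \<eta>(1) y z] .
  then have bdd: "bounded (range y)"
    by (intro bounded_subset[OF bounded_cball[of z "norm (g z) / \<mu>"]])
       (auto simp: dist_norm norm_minus_commute)
  \<comment> \<open>Monotonicity again eliminates \<open>F\<close>, leaving a gradient inequality at
    \<open>y k\<close>; strong convexity converts it into a comparison of values that survives the
    passage to the limit.\<close>
  have fy: "f (y k) + \<mu> / 2 * (norm (z - y k))\<^sup>2 \<le> f z" if z: "z \<in> SOL X F" for k z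
  proof -
    have "(F (y k) + \<eta> k *\<^sub>R g (y k)) \<bullet> (z - y k) \<ge> 0" "F z \<bullet> (y k - z) \<ge> 0"
      "(F (y k) - F z) \<bullet> (y k - z) \<ge> 0"
      using y[of k] z mono by (auto simp: SOL_def vi_monotone_on_def)
    then have "0 \<le> \<eta> k * (g (y k) \<bullet> (z - y k))"
      by (simp add: algebra_simps)
    then have "0 \<le> g (y k) \<bullet> (z - y k)" using \<eta>(1)[of k] by (simp add: zero_le_mult_iff)
    moreover have "f z \<ge> f (y k) + g (y k) \<bullet> (z - y k) + \<mu> / 2 * (norm (z - y k))\<^sup>2"
      using sc(2) yX z by (auto simp: strongly_convex_on_def SOL_def)
    ultimately show ?thesis by simp
  qed
  have cluster: "l \<in> SOL X F \<and> (\<forall>z\<in>SOL X F. f l + \<mu> / 2 * (norm (z - l))\<^sup>2 \<le> f z)"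
    if r: "strict_mono r" and l: "(y \<circ> r) \<longlonglongrightarrow> l" for r l
  proof -
    have l': "(\<lambda>n. y (r n)) \<longlonglongrightarrow> l" using l by (simp add: o_def)
    have lX: "l \<in> X" using closed_sequentially[OF X _ l'] yX by simp
    have lim: "(\<lambda>n. h (y (r n))) \<longlonglongrightarrow> h l" if "continuous_on X h" for h :: "'a \<Rightarrow> 'b::topological_space"
      using continuous_on_tendsto_compose[OF that l' lX] yX by simp
    have \<eta>r: "(\<lambda>n. \<eta> (r n)) \<longlonglongrightarrow> 0"
      using LIMSEQ_subseq_LIMSEQ[OF \<eta>(2) r] by (simp add: o_def)
    have "F l \<bullet> (w - l) \<ge> 0" if w: "w \<in> X" for w
    proof (rule LIMSEQ_le_const)
      have "(\<lambda>n. (F (y (r n)) + \<eta> (r n) *\<^sub>R g (y (r n))) \<bullet> (w - y (r n)))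
          \<longlonglongrightarrow> (F l + 0 *\<^sub>R g l) \<bullet> (w - l)"
        by (intro tendsto_intros lim cont l' \<eta>r)
      then show "(\<lambda>n. (F (y (r n)) + \<eta> (r n) *\<^sub>R g (y (r n))) \<bullet> (w - y (r n))) \<longlonglongrightarrow> F l \<bullet> (w - l)"
        by simp
      show "\<exists>N. \<forall>n\<ge>N. 0 \<le> (F (y (r n)) + \<eta> (r n) *\<^sub>R g (y (r n))) \<bullet> (w - y (r n))"
        using y w by (auto simp: SOL_def)
    qed
    then have "l \<in> SOL X F" using lX by (simp add: SOL_def)
    moreover have "f l + \<mu> / 2 * (norm (z - l))\<^sup>2 \<le> f z" if z: "z \<in> SOL X F" for z
    proof (rule LIMSEQ_le_const2)
      show "(\<lambda>n. f (y (r n)) + \<mu> / 2 * (norm (z - y (r n)))\<^sup>2) \<longlonglongrightarrow> f l + \<mu> / 2 * (norm (z - l))\<^sup>2"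
        by (intro tendsto_intros lim cont l')
    qed (use fy[OF z] in auto)
    ultimately show ?thesis by blast
  qed
  obtain l r where lr: "strict_mono r" "(y \<circ> r) \<longlonglongrightarrow> l"
    using bounded_imp_convergent_subsequence[OF bdd] by blast
  note l = cluster[OF lr]
  have uniq: "l' = l" if "l' \<in> SOL X F" "f l' \<le> f l" for l'
  proof -
    have "\<mu> / 2 * (norm (l' - l))\<^sup>2 \<le> 0" using l that by force
    then show ?thesis using sc(1) by (simp add: mult_le_0_iff)
  qed
  have "is_arg_min f (\<lambda>x. x \<in> SOL X F) l"
  proof -
    have "f l \<le> f z" if "z \<in> SOL X F" for z
    proof -
      have "0 \<le> \<mu> / 2 * (norm (z - l))\<^sup>2" using sc(1) by simp
      then show ?thesis using l that by force
    qed
    then show ?thesis unfolding is_arg_min_def using l by (auto simp: not_less)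
  qed
  \<comment> \<open>\<open>arg_min_on\<close> is a choice term; the minimizer \<open>l\<close> just
    found guarantees that it denotes a minimizer, and uniqueness makes it \<open>l\<close>.\<close>
  then have "is_arg_min f (\<lambda>x. x \<in> SOL X F) (arg_min_on f (SOL X F))"
    unfolding arg_min_on_def arg_min_def by (rule someI)
  then have amin: "arg_min_on f (SOL X F) = l"
    using l by (intro uniq) (auto simp: is_arg_min_def not_less)
  have "y \<longlonglongrightarrow> l"
  \<comment> \<open>A subsequence staying away from \<open>l\<close> would have a further convergent
    subsequence, whose limit is again a cluster point of \<open>y\<close> and hence
    \<open>l\<close>.\<close>
  proof (rule ccontr)
    assume "\<not> y \<longlonglongrightarrow> l"
    then obtain e where e: "0 < e" "\<not> (\<forall>\<^sub>F n in sequentially. dist (y n) l < e)"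
      by (auto simp: tendsto_iff)
    obtain r :: "nat \<Rightarrow> nat" where r: "strict_mono r" "\<And>n. \<not> dist (y (r n)) l < e"
      using not_eventually_sequentiallyD[OF e(2)] by blast
    have "bounded (range (y \<circ> r))" using bdd by (rule bounded_subset) auto
    then obtain l' r' where r': "strict_mono r'" "((y \<circ> r) \<circ> r') \<longlonglongrightarrow> l'"
      using bounded_imp_convergent_subsequence by blast
    have "strict_mono (r \<circ> r')" using r(1) r'(1) by (rule strict_mono_o)
    then have l': "l' \<in> SOL X F \<and> (\<forall>z\<in>SOL X F. f l' + \<mu> / 2 * (norm (z - l'))\<^sup>2 \<le> f z)"
      using r'(2) by (intro cluster) (auto simp: o_assoc)
    have "0 \<le> \<mu> / 2 * (norm (l - l'))\<^sup>2" using sc(1) by simp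
    then have "f l' \<le> f l" using l' l by force
    then have "l' = l" using l' uniq by blast
    then have "\<forall>\<^sub>F n in sequentially. dist ((y \<circ> r \<circ> r') n) l < e"
      using r'(2) e(1) by (simp add: tendsto_iff)
    then show False using r(2) by (auto simp: eventually_sequentially)
  qed
  then show ?thesis using amin by simp
qed

section \<open>The block-coordinate step\<close>

lemma block_add: "block \<beta> i (x + y) = block \<beta> i x + block \<beta> i y"
  and block_diff: "block \<beta> i (x - y) = block \<beta> i x - block \<beta> i y"
  and block_scaleR: "block \<beta> i (c *\<^sub>R x) = c *\<^sub>R block \<beta> i x"
  by (auto simp: block_def vec_eq_iff)

lemma block_block: "block \<beta> i (block \<beta> k x) = (if i = k then block \<beta> i x else 0)"
  by (auto simp: block_def vec_eq_iff)

lemma linear_block: "linear (block \<beta> i)"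
  by (rule linearI) (simp_all add: block_add block_scaleR)

lemma block_inner: "block \<beta> i x \<bullet> block \<beta> i y = block \<beta> i x \<bullet> y"
  by (auto simp: block_def inner_vec_def intro!: sum.cong)

lemma sum_block: "(\<Sum>i\<in>UNIV. block \<beta> i x) = x"
  for \<beta> :: "'n::finite \<Rightarrow> 'd::finite"
  by (simp add: block_def vec_eq_iff)

lemma sum_block_inner: "(\<Sum>i\<in>UNIV. block \<beta> i x \<bullet> block \<beta> i y) = x \<bullet> y"
  for \<beta> :: "'n::finite \<Rightarrow> 'd::finite"
  by (simp add: block_inner inner_sum_left[symmetric] sum_block)

lemma closed_block_prod:
  assumes "\<And>i. closed (Xs i)"
  shows "closed (block_prod \<beta> Xs)"
proof -
  have "closed (block \<beta> i -` Xs i)" for i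
    by (intro closed_vimage assms linear_continuous_on linear_conv_bounded_linear[THEN iffD1] linear_block)
  moreover have "block_prod \<beta> Xs = (\<Inter>i. block \<beta> i -` Xs i)"
    by (auto simp: block_prod_def)
  ultimately show ?thesis by auto
qed

lemma convex_block_prod:
  assumes "\<And>i. convex (Xs i)"
  shows "convex (block_prod \<beta> Xs)"
proof -
  have "block_prod \<beta> Xs = (\<Inter>i. block \<beta> i -` Xs i)"
    by (auto simp: block_prod_def)
  then show ?thesis by (auto intro!: convex_INT convex_linear_vimage linear_block assms)
qed

text \<open>The coordinatewise update written additively on whole vectors, with the regularized map
  as one argument \<open>G\<close>, so that inner product identities and measurability of sums apply
  directly.\<close>

definition aRB_step ::
  "('n::finite \<Rightarrow> 'd) \<Rightarrow> ('d \<Rightarrow> (real ^ 'n) set) \<Rightarrow> (real ^ 'n \<Rightarrow> real ^ 'n) \<Rightarrow> real \<Rightarrow> 'd \<Rightarrow> real ^ 'n \<Rightarrow> real ^ 'n" where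
  "aRB_step \<beta> Xs G c i x =
     x - block \<beta> i x + closest_point (Xs i) (block \<beta> i x - c *\<^sub>R block \<beta> i (G x))"

text \<open>The obtuse angle condition characterizes projections: expanding the squared distance
  from \<open>a\<close> to \<open>z\<close> around \<open>x\<close> leaves only nonnegative extra
  terms.\<close>

lemma closest_point_eqI:
  fixes S :: "'a::euclidean_space set"
  assumes S: "convex S" "closed S" and x: "x \<in> S" and le: "\<And>z. z \<in> S \<Longrightarrow> (a - x) \<bullet> (z - x) \<le> 0"
  shows "closest_point S a = x"
proof (rule closest_point_unique[OF S x, symmetric], rule ballI)
  fix z assume z: "z \<in> S"
  have "0 \<le> (z - x) \<bullet> (z - x)" by simp
  then have "(a - x) \<bullet> (a - x) \<le> (a - z) \<bullet> (a - z)"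
    using le[OF z] by (simp add: algebra_simps inner_commute)
  then show "dist a x \<le> dist a z" by (simp add: dist_norm norm_le)
qed

lemma block_of_range: "p \<in> range (block \<beta> i) \<Longrightarrow> block \<beta> i p = p"
  by (auto simp: block_block)

text \<open>A point of \<open>Xs i\<close> vanishes outside block \<open>i\<close>, which is why the
  additive and the coordinatewise update agree.\<close>

lemma aRB_iter_Suc:
  assumes "\<And>i. Xs i \<subseteq> range (block \<beta> i)" "\<And>i. Xs i \<noteq> {}" "\<And>i. closed (Xs i)"
  shows "aRB_iter \<beta> Xs F g \<gamma> \<eta> x0 idx (Suc k) =
    aRB_step \<beta> Xs (\<lambda>x. F x + \<eta> k *\<^sub>R g x) (\<gamma> k) (idx k) (aRB_iter \<beta> Xs F g \<gamma> \<eta> x0 idx k)"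
proof -
  have upd: "(\<chi> j. if \<beta> j = i then p $ j else x $ j) = x - block \<beta> i x + p" if p: "p \<in> Xs i" for p x i
  proof -
    obtain q where "p = block \<beta> i q" using p assms(1)[of i] by blast
    then show ?thesis by (simp add: vec_eq_iff block_def)
  qed
  show ?thesis
    by (simp add: Let_def aRB_step_def upd closest_point_in_set assms block_add block_scaleR)
qed

lemma block_aRB_step:
  assumes "Xs i \<subseteq> range (block \<beta> i)" "Xs i \<noteq> {}" "closed (Xs i)"
  shows "block \<beta> k (aRB_step \<beta> Xs G c i x) =
    (if k = i then closest_point (Xs i) (block \<beta> i x - c *\<^sub>R block \<beta> i (G x)) else block \<beta> k x)"
proof -
  define p where "p = closest_point (Xs i) (block \<beta> i x - c *\<^sub>R block \<beta> i (G x))"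
  have "p \<in> Xs i" unfolding p_def using assms by (intro closest_point_in_set)
  then obtain q where "p = block \<beta> i q" using assms(1) by blast
  then show ?thesis
    unfolding aRB_step_def p_def[symmetric] by (auto simp: block_add block_diff block_block)
qed

lemma aRB_step_in_block_prod:
  assumes "\<And>i. Xs i \<subseteq> range (block \<beta> i)" "\<And>i. Xs i \<noteq> {}" "\<And>i. closed (Xs i)"
    and "x \<in> block_prod \<beta> Xs"
  shows "aRB_step \<beta> Xs G c i x \<in> block_prod \<beta> Xs"
  using assms by (auto simp: block_prod_def block_aRB_step closest_point_in_set)

text \<open>Over a product the inequality decouples: changing block \<open>i\<close> alone stays
  feasible, so block \<open>i\<close> of \<open>y\<close> satisfies the obtuse angle condition for
  its own projected step.\<close>

lemma SOL_block_fixed_point: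
  fixes \<beta> :: "'n::finite \<Rightarrow> 'd"
  assumes Xs: "Xs i \<subseteq> range (block \<beta> i)" "closed (Xs i)" "convex (Xs i)"
    and y: "y \<in> SOL (block_prod \<beta> Xs) G" and c: "0 \<le> c"
  shows "closest_point (Xs i) (block \<beta> i y - c *\<^sub>R block \<beta> i (G y)) = block \<beta> i y"
proof (rule closest_point_eqI[OF Xs(3,2)])
  have yX: "y \<in> block_prod \<beta> Xs" using y by (simp add: SOL_def)
  then show "block \<beta> i y \<in> Xs i" by (simp add: block_prod_def)
  fix v assume v: "v \<in> Xs i"
  then obtain q where q: "v = block \<beta> i q" using Xs(1) by blast
  \<comment> \<open>This point is \<open>y\<close> with its block \<open>i\<close> replaced by
    \<open>v\<close>.\<close>
  have "y + (v - block \<beta> i y) \<in> block_prod \<beta> Xs"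
    using yX v by (auto simp: block_prod_def block_add block_diff block_block q)
  then have "0 \<le> G y \<bullet> (v - block \<beta> i y)" using y by (auto simp: SOL_def)
  also have "\<dots> = block \<beta> i (G y) \<bullet> (v - block \<beta> i y)"
    unfolding q block_diff[symmetric] by (metis block_inner inner_commute)
  finally have "0 \<le> c * (block \<beta> i (G y) \<bullet> (v - block \<beta> i y))" using c by simp
  then show "(block \<beta> i y - c *\<^sub>R block \<beta> i (G y) - block \<beta> i y) \<bullet> (v - block \<beta> i y) \<le> 0" by simp
qed

text \<open>Pythagoras splits off the coordinates that the step leaves alone. Within block
  \<open>i\<close>, \<open>y\<close> is a fixed point of its own projected step, so nonexpansiveness
  of the projection compares the two points before projection.\<close>

lemma aRB_step_dist:
  fixes \<beta> :: "'n::finite \<Rightarrow> 'd"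
  assumes Xs: "Xs i \<subseteq> range (block \<beta> i)" "Xs i \<noteq> {}" "closed (Xs i)" "convex (Xs i)"
    and y: "y \<in> SOL (block_prod \<beta> Xs) G" and c: "0 \<le> c"
  shows "(norm (aRB_step \<beta> Xs G c i x - y))\<^sup>2 \<le> (norm (x - y))\<^sup>2
    - 2 * c * (block \<beta> i (x - y) \<bullet> block \<beta> i (G x - G y)) + c\<^sup>2 * (norm (block \<beta> i (G x - G y)))\<^sup>2"
proof -
  define p where "p = closest_point (Xs i) (block \<beta> i x - c *\<^sub>R block \<beta> i (G x))"
  \<comment> \<open>The part of \<open>x - y\<close> outside block \<open>i\<close>, orthogonal to
    every vector of that block.\<close>
  define u where "u = (x - y) - block \<beta> i (x - y)"
  define D where "D = block \<beta> i (x - y)"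
  define E where "E = block \<beta> i (G x - G y)"
  have "p \<in> Xs i" unfolding p_def using Xs by (intro closest_point_in_set)
  then have bp: "block \<beta> i p = p" using Xs(1) by (intro block_of_range) auto
  have bu: "block \<beta> i u = 0" by (simp add: u_def block_diff block_block)
  have orth: "block \<beta> i v \<bullet> u = 0" for v
    using block_inner[of \<beta> i v u] bu by simp
  have "block \<beta> i (p - y) \<bullet> u = 0" "D \<bullet> u = 0" unfolding D_def by (rule orth)+
  then have o: "(p - block \<beta> i y) \<bullet> u = 0" "u \<bullet> D = 0"
    by (simp_all add: block_diff bp inner_commute)
  have "aRB_step \<beta> Xs G c i x - y = u + (p - block \<beta> i y)"
    by (simp add: aRB_step_def p_def[symmetric] u_def block_diff)
  then have 1: "(norm (aRB_step \<beta> Xs G c i x - y))\<^sup>2 = (norm u)\<^sup>2 + (norm (p - block \<beta> i y))\<^sup>2"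
    using o(1) by (simp only: norm_add_Pythagorean orthogonal_def inner_commute)
  have "x - y = u + D" by (simp add: u_def D_def)
  then have 2: "(norm (x - y))\<^sup>2 = (norm u)\<^sup>2 + (norm D)\<^sup>2"
    using o(2) by (simp only: norm_add_Pythagorean orthogonal_def)
  have "norm (p - block \<beta> i y) \<le> norm (D - c *\<^sub>R E)"
    using closest_point_lipschitz[OF Xs(4,3,2), of "block \<beta> i x - c *\<^sub>R block \<beta> i (G x)" "block \<beta> i y - c *\<^sub>R block \<beta> i (G y)"]
    unfolding p_def[symmetric] SOL_block_fixed_point[OF Xs(1,3,4) y c]
    by (simp add: dist_norm D_def E_def block_diff algebra_simps)
  then have "(norm (p - block \<beta> i y))\<^sup>2 \<le> (norm (D - c *\<^sub>R E))\<^sup>2" by simp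
  also have "\<dots> = (norm D)\<^sup>2 - 2 * c * (D \<bullet> E) + c\<^sup>2 * (norm E)\<^sup>2"
    unfolding power2_norm_eq_inner
    by (simp add: power2_eq_square inner_commute algebra_simps)
  finally show ?thesis using 1 2 by (simp add: D_def E_def)
qed

text \<open>Monotonicity is available for whole vectors and not for single blocks; summing over all
  blocks, which is \<open>d\<close> times the mean over a uniform draw, restores the full inner
  product.\<close>

lemma sum_aRB_step_dist:
  fixes \<beta> :: "'n::finite \<Rightarrow> 'd::finite"
  assumes Xs: "\<And>i. Xs i \<subseteq> range (block \<beta> i)" "\<And>i. Xs i \<noteq> {}" "\<And>i. closed (Xs i)" "\<And>i. convex (Xs i)"
    and y: "y \<in> SOL (block_prod \<beta> Xs) G" and c: "0 \<le> c"
  shows "(\<Sum>i\<in>UNIV. (norm (aRB_step \<beta> Xs G c i x - y))\<^sup>2) \<le> real CARD('d) * (norm (x - y))\<^sup>2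
    - 2 * c * ((x - y) \<bullet> (G x - G y)) + c\<^sup>2 * (norm (G x - G y))\<^sup>2"
proof -
  have "(\<Sum>i\<in>UNIV. (norm (aRB_step \<beta> Xs G c i x - y))\<^sup>2) \<le> (\<Sum>i\<in>UNIV. (norm (x - y))\<^sup>2
    - 2 * c * (block \<beta> i (x - y) \<bullet> block \<beta> i (G x - G y)) + c\<^sup>2 * (norm (block \<beta> i (G x - G y)))\<^sup>2)"
    by (intro sum_mono aRB_step_dist Xs y c)
  also have "\<dots> = real CARD('d) * (norm (x - y))\<^sup>2
    - 2 * c * (\<Sum>i\<in>UNIV. block \<beta> i (x - y) \<bullet> block \<beta> i (G x - G y))
    + c\<^sup>2 * (\<Sum>i\<in>UNIV. block \<beta> i (G x - G y) \<bullet> block \<beta> i (G x - G y))"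
    by (simp add: sum.distrib sum_subtractf sum_distrib_left power2_norm_eq_inner)
  finally show ?thesis by (simp add: sum_block_inner power2_norm_eq_inner)
qed

text \<open>Young's inequality: a small \<open>s\<close> keeps the factor of the first square close
  to one, at the price \<open>1 / s\<close> for the second.\<close>

lemma norm_add_square_le:
  fixes u v :: "'a::real_inner"
  assumes "0 < s"
  shows "(norm (u + v))\<^sup>2 \<le> (1 + s) * (norm u)\<^sup>2 + (1 + 1 / s) * (norm v)\<^sup>2"
proof -
  have "0 \<le> (s * norm u - norm v)\<^sup>2 / s" using assms by simp
  also have "\<dots> = s * (norm u)\<^sup>2 - 2 * (norm u * norm v) + (norm v)\<^sup>2 / s"
    using assms by (simp add: power2_eq_square field_simps)
  finally have "2 * (norm u * norm v) \<le> s * (norm u)\<^sup>2 + (norm v)\<^sup>2 / s" by simp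
  moreover have "(norm (u + v))\<^sup>2 \<le> (norm u + norm v)\<^sup>2"
    by (intro power_mono norm_triangle_ineq) auto
  ultimately show ?thesis by (simp add: power2_sum algebra_simps)
qed

text \<open>The bound by \<open>\<eta>0\<close> makes the constants independent of the
  iteration.\<close>

lemma regularized_growth:
  fixes F g :: "'a::real_inner \<Rightarrow> 'a"
  assumes "(norm (F x - F y))\<^sup>2 \<le> L_F\<^sup>2 * (norm (x - y))\<^sup>2 + B_F"
    and "norm (g x - g y) \<le> L_f * norm (x - y)" and "0 \<le> \<eta>" "\<eta> \<le> \<eta>0"
  shows "(norm ((F x + \<eta> *\<^sub>R g x) - (F y + \<eta> *\<^sub>R g y)))\<^sup>2
    \<le> (2 * L_F\<^sup>2 + 2 * \<eta>0\<^sup>2 * L_f\<^sup>2) * (norm (x - y))\<^sup>2 + 2 * B_F"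
proof -
  have eq: "(F x + \<eta> *\<^sub>R g x) - (F y + \<eta> *\<^sub>R g y) = (F x - F y) + \<eta> *\<^sub>R (g x - g y)"
    by (simp add: algebra_simps)
  have "(norm ((F x + \<eta> *\<^sub>R g x) - (F y + \<eta> *\<^sub>R g y)))\<^sup>2
      \<le> 2 * (norm (F x - F y))\<^sup>2 + 2 * (\<eta> * norm (g x - g y))\<^sup>2"
    using norm_add_square_le[of 1 "F x - F y" "\<eta> *\<^sub>R (g x - g y)"] assms(3) by (simp add: eq power_mult_distrib)
  moreover have "(\<eta> * norm (g x - g y))\<^sup>2 \<le> (\<eta>0 * (L_f * norm (x - y)))\<^sup>2"
    using assms by (intro power_mono mult_mono) auto
  ultimately show ?thesis using assms(1) by (simp add: power_mult_distrib algebra_simps)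
qed

text \<open>Budget for the contraction: strong monotonicity of the regularizer gains
  \<open>2 * t\<close>, the growth term gives back \<open>t / 2\<close>, and moving the reference
  point from \<open>y\<close> to \<open>y'\<close> gives back another \<open>t / 2\<close>, so a
  factor \<open>1 - t\<close> remains.\<close>

lemma aRB_step_mean_recursion:
  fixes \<beta> :: "'n::finite \<Rightarrow> 'd::finite" and F g :: "real ^ 'n \<Rightarrow> real ^ 'n"
  assumes Xs: "\<And>i. Xs i \<subseteq> range (block \<beta> i)" "\<And>i. Xs i \<noteq> {}" "\<And>i. closed (Xs i)" "\<And>i. convex (Xs i)"
    and y: "y \<in> SOL (block_prod \<beta> Xs) (\<lambda>x. F x + \<eta> *\<^sub>R g x)"
    and mono: "(F x - F y) \<bullet> (x - y) \<ge> 0"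
    and g: "\<mu> * (norm (x - y))\<^sup>2 \<le> (g x - g y) \<bullet> (x - y)"
    and growth: "(norm ((F x + \<eta> *\<^sub>R g x) - (F y + \<eta> *\<^sub>R g y)))\<^sup>2 \<le> C * (norm (x - y))\<^sup>2 + 2 * B_F"
    and pos: "0 \<le> B_F" "0 < \<mu>" "0 < c" "0 < \<eta>"
    and t: "t = c * \<eta> * \<mu> / real CARD('d)" "t \<le> 1" "c\<^sup>2 * C / real CARD('d) \<le> t / 2"
  shows "(\<Sum>i\<in>UNIV. (norm (aRB_step \<beta> Xs (\<lambda>x. F x + \<eta> *\<^sub>R g x) c i x - y'))\<^sup>2) / real CARD('d)
    \<le> (1 - t) * (norm (x - y))\<^sup>2 + (4 * c\<^sup>2 * B_F / real CARD('d) + 3 / t * (norm (y - y'))\<^sup>2)"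
proof -
  define d where "d = real CARD('d)"
  define G where "G x = F x + \<eta> *\<^sub>R g x" for x
  define e where "e = (norm (x - y))\<^sup>2"
  define V where "V = (\<Sum>i\<in>UNIV. (norm (aRB_step \<beta> Xs G c i x - y))\<^sup>2) / d"
  have d: "0 < d" by (simp add: d_def)
  have t0: "0 < t" unfolding t(1) using pos by simp
  have e: "0 \<le> e" by (simp add: e_def)
  have "\<eta> * (\<mu> * e) \<le> \<eta> * ((g x - g y) \<bullet> (x - y))" using g pos by (simp add: e_def)
  then have "\<eta> * \<mu> * e \<le> (x - y) \<bullet> (G x - G y)"
    using mono by (simp add: G_def inner_commute algebra_simps)
  then have "2 * c * (\<eta> * \<mu> * e) \<le> 2 * c * ((x - y) \<bullet> (G x - G y))" using pos by simp
  moreover have "d * t = c * \<eta> * \<mu>" using d by (simp add: t(1) d_def[symmetric])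
  then have "2 * c * (\<eta> * \<mu> * e) = d * (2 * t * e)" by (simp add: mult.assoc[symmetric])
  moreover have "c\<^sup>2 * (norm (G x - G y))\<^sup>2 \<le> c\<^sup>2 * (C * e + 2 * B_F)"
    using growth by (intro mult_left_mono) (auto simp: G_def e_def)
  moreover have "c\<^sup>2 * C * e \<le> d * (t / 2) * e"
    using t(3) d e by (intro mult_right_mono) (auto simp: d_def[symmetric] field_simps)
  moreover have "d * V \<le> d * e - 2 * c * ((x - y) \<bullet> (G x - G y)) + c\<^sup>2 * (norm (G x - G y))\<^sup>2"
  proof -
    have "y \<in> SOL (block_prod \<beta> Xs) G" using y unfolding G_def .
    moreover have "d * V = (\<Sum>i\<in>UNIV. (norm (aRB_step \<beta> Xs G c i x - y))\<^sup>2)" using d by (simp add: V_def)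
    ultimately show ?thesis using sum_aRB_step_dist[OF Xs, of y G c x] pos by (simp add: d_def e_def)
  qed
  moreover have "d * ((1 - 3 * t / 2) * e + 2 * c\<^sup>2 * B_F / d)
      = d * e - d * (2 * t * e) + d * (t / 2) * e + 2 * (c\<^sup>2 * B_F)"
    using d by (simp add: field_simps)
  moreover have "c\<^sup>2 * (C * e + 2 * B_F) = c\<^sup>2 * C * e + 2 * (c\<^sup>2 * B_F)"
    by (simp add: algebra_simps)
  ultimately have "d * V \<le> d * ((1 - 3 * t / 2) * e + 2 * c\<^sup>2 * B_F / d)"
    by linarith
  then have V: "V \<le> (1 - 3 * t / 2) * e + 2 * c\<^sup>2 * B_F / d" using d by simp
  \<comment> \<open>Change of reference point by Young's inequality with parameter
    \<open>t / 2\<close>.\<close>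
  have "(\<Sum>i\<in>UNIV. (norm (aRB_step \<beta> Xs G c i x - y'))\<^sup>2)
      \<le> (\<Sum>i\<in>(UNIV::'d set). (1 + t / 2) * (norm (aRB_step \<beta> Xs G c i x - y))\<^sup>2 + (1 + 2 / t) * (norm (y - y'))\<^sup>2)"
  proof (rule sum_mono)
    fix i :: 'd
    show "(norm (aRB_step \<beta> Xs G c i x - y'))\<^sup>2
      \<le> (1 + t / 2) * (norm (aRB_step \<beta> Xs G c i x - y))\<^sup>2 + (1 + 2 / t) * (norm (y - y'))\<^sup>2"
      using norm_add_square_le[of "t / 2" "aRB_step \<beta> Xs G c i x - y" "y - y'"] t0 by simp
  qed
  also have "\<dots> = d * ((1 + t / 2) * V + (1 + 2 / t) * (norm (y - y'))\<^sup>2)"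
  proof -
    have "(\<Sum>i\<in>UNIV. (norm (aRB_step \<beta> Xs G c i x - y))\<^sup>2) = d * V" using d by (simp add: V_def)
    then show ?thesis
      by (simp add: sum.distrib sum_distrib_left[symmetric] d_def distrib_left mult.left_commute)
  qed
  finally have "(\<Sum>i\<in>UNIV. (norm (aRB_step \<beta> Xs G c i x - y'))\<^sup>2) / d
      \<le> (1 + t / 2) * V + (1 + 2 / t) * (norm (y - y'))\<^sup>2"
    using d by (simp add: pos_divide_le_eq mult.commute)
  also have "(1 + t / 2) * V \<le> (1 + t / 2) * ((1 - 3 * t / 2) * e + 2 * c\<^sup>2 * B_F / d)"
    using V t0 by (intro mult_left_mono) auto
  also have "\<dots> = (1 + t / 2) * (1 - 3 * t / 2) * e + (1 + t / 2) * (2 * c\<^sup>2 * B_F / d)"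
    by (simp only: distrib_left mult.assoc)
  also have "(1 + t / 2) * (1 - 3 * t / 2) * e \<le> (1 - t) * e"
  proof (rule mult_right_mono[OF _ e])
    have "(1 + t / 2) * (1 - 3 * t / 2) = 1 - t - 3 / 4 * t\<^sup>2"
      by (simp add: power2_eq_square field_simps)
    then show "(1 + t / 2) * (1 - 3 * t / 2) \<le> 1 - t" by simp
  qed
  \<comment> \<open>From \<open>t \<le> 1\<close> come \<open>1 + t / 2 \<le> 2\<close> and, for the
    drift term below, \<open>1 + 2 / t \<le> 3 / t\<close>.\<close>
  also have "(1 + t / 2) * (2 * c\<^sup>2 * B_F / d) \<le> 2 * (2 * c\<^sup>2 * B_F / d)"
    using t pos d by (intro mult_right_mono) auto
  also have "(1 + 2 / t) * (norm (y - y'))\<^sup>2 \<le> 3 / t * (norm (y - y'))\<^sup>2"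
    using t(2) t0 by (intro mult_right_mono) (auto simp: field_simps)
  finally show ?thesis unfolding G_def d_def e_def by simp
qed

text \<open>A bound for every single block and any step size, serving only to propagate
  integrability; hence the generous factor and its product form with the squared distance plus
  one.\<close>

lemma aRB_step_dist_crude:
  fixes \<beta> :: "'n::finite \<Rightarrow> 'd" and F g :: "real ^ 'n \<Rightarrow> real ^ 'n"
  assumes Xs: "Xs i \<subseteq> range (block \<beta> i)" "Xs i \<noteq> {}" "closed (Xs i)" "convex (Xs i)"
    and y: "y \<in> SOL (block_prod \<beta> Xs) G"
    and growth: "(norm (G x - G y))\<^sup>2 \<le> C * (norm (x - y))\<^sup>2 + B"
    and pos: "0 \<le> B" "0 \<le> C" "0 \<le> c"
  shows "(norm (aRB_step \<beta> Xs G c i x - y'))\<^sup>2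
    \<le> (4 + 4 * c\<^sup>2 * C + 4 * c\<^sup>2 * B + 2 * (norm (y - y'))\<^sup>2) * ((norm (x - y))\<^sup>2 + 1)"
proof -
  define D where "D = block \<beta> i (x - y)"
  define E where "E = block \<beta> i (G x - G y)"
  have le: "norm (block \<beta> i v) \<le> norm v" for v :: "real ^ 'n"
    by (rule norm_le_componentwise_cart) (simp add: block_def)
  \<comment> \<open>Expanding this square bounds the cross term from below without monotonicity,
    which a single block does not inherit.\<close>
  have "0 \<le> (norm (D + c *\<^sub>R E))\<^sup>2" by simp
  then have "- (2 * c * (D \<bullet> E)) \<le> (norm D)\<^sup>2 + c\<^sup>2 * (norm E)\<^sup>2"
    unfolding power2_norm_eq_inner by (simp add: power2_eq_square inner_commute algebra_simps)
  moreover have "(norm D)\<^sup>2 \<le> (norm (x - y))\<^sup>2" unfolding D_def by (intro power_mono le) auto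
  moreover have "c\<^sup>2 * (norm E)\<^sup>2 \<le> c\<^sup>2 * (C * (norm (x - y))\<^sup>2 + B)"
  proof (rule mult_left_mono)
    have "(norm E)\<^sup>2 \<le> (norm (G x - G y))\<^sup>2" unfolding E_def by (intro power_mono le) auto
    then show "(norm E)\<^sup>2 \<le> C * (norm (x - y))\<^sup>2 + B" using growth by (rule order_trans)
  qed simp
  ultimately have 1: "(norm (aRB_step \<beta> Xs G c i x - y))\<^sup>2
      \<le> 2 * (norm (x - y))\<^sup>2 + 2 * (c\<^sup>2 * (C * (norm (x - y))\<^sup>2 + B))"
    using aRB_step_dist[OF Xs y pos(3), of x] unfolding D_def E_def by linarith
  have "(norm (aRB_step \<beta> Xs G c i x - y'))\<^sup>2
      \<le> 2 * (norm (aRB_step \<beta> Xs G c i x - y))\<^sup>2 + 2 * (norm (y - y'))\<^sup>2"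
    using norm_add_square_le[of 1 "aRB_step \<beta> Xs G c i x - y" "y - y'"] by simp
  with 1 have "(norm (aRB_step \<beta> Xs G c i x - y'))\<^sup>2
      \<le> 4 * (norm (x - y))\<^sup>2 + 4 * (c\<^sup>2 * (C * (norm (x - y))\<^sup>2 + B)) + 2 * (norm (y - y'))\<^sup>2"
    by simp
  moreover have "0 \<le> 4 * c\<^sup>2 * C" "0 \<le> 4 * c\<^sup>2 * B * (norm (x - y))\<^sup>2" "0 \<le> (norm (y - y'))\<^sup>2 * (norm (x - y))\<^sup>2"
    using pos by auto
  moreover have "(4 + 4 * c\<^sup>2 * C + 4 * c\<^sup>2 * B + 2 * (norm (y - y'))\<^sup>2) * ((norm (x - y))\<^sup>2 + 1)
      = 4 * (norm (x - y))\<^sup>2 + 4 * (c\<^sup>2 * (C * (norm (x - y))\<^sup>2 + B)) + 2 * (norm (y - y'))\<^sup>2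
        + (4 + 4 * c\<^sup>2 * C + 4 * c\<^sup>2 * B * (norm (x - y))\<^sup>2 + 2 * ((norm (y - y'))\<^sup>2 * (norm (x - y))\<^sup>2))"
    by (simp add: algebra_simps)
  ultimately show ?thesis by linarith
qed

text \<open>\<open>G\<close> is continuous on \<open>X\<close> only, so its composition with
  \<open>x\<close> is measurable because \<open>x\<close> takes values in \<open>X\<close>.\<close>

lemma measurable_aRB_step:
  fixes \<beta> :: "'n::finite \<Rightarrow> 'd"
  assumes Xs: "Xs i \<noteq> {}" "closed (Xs i)" "convex (Xs i)"
    and x: "x \<in> borel_measurable N" "\<And>\<omega>. \<omega> \<in> space N \<Longrightarrow> x \<omega> \<in> X"
    and G: "continuous_on X G"
  shows "(\<lambda>\<omega>. aRB_step \<beta> Xs G c i (x \<omega>)) \<in> borel_measurable N"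
proof -
  have [measurable]: "block \<beta> i \<in> borel_measurable borel"
    by (intro borel_measurable_continuous_onI linear_continuous_on linear_conv_bounded_linear[THEN iffD1] linear_block)
  have [measurable]: "closest_point (Xs i) \<in> borel_measurable borel"
    by (intro borel_measurable_continuous_onI continuous_on_closest_point Xs)
  have [measurable]: "(\<lambda>\<omega>. G (x \<omega>)) \<in> borel_measurable N"
    using measurable_compose[OF measurable_restrict_space2[OF _ x(1)] borel_measurable_continuous_on_restrict[OF G]] x(2)
    by auto
  note [measurable] = x(1)
  show ?thesis unfolding aRB_step_def by measurable
qed

section \<open>Convergence of the averages\<close>

text \<open>\<open>xbar 0\<close> is \<open>x0\<close>, so finite mean distances force
  \<open>x0\<close> to be integrable. Integrability of the distances is asserted beside their limit
  because the expectation of a non-integrable function is \<open>0\<close> by default.\<close>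

theorem theorem4p11:
  fixes \<beta> :: "'n::finite \<Rightarrow> 'd::finite"
    and Xs :: "'d \<Rightarrow> (real ^ 'n) set" and X :: "(real ^ 'n) set"
    and f :: "real ^ 'n \<Rightarrow> real" and g F :: "real ^ 'n \<Rightarrow> real ^ 'n"
    and \<mu> L_f L_F B_F :: real and xstar :: "real ^ 'n"
    and M :: "'w measure" and x0 :: "'w \<Rightarrow> real ^ 'n" and ix :: "nat \<Rightarrow> 'w \<Rightarrow> 'd"
    and \<gamma> \<eta> :: "nat \<Rightarrow> real" and \<gamma>0 \<eta>0 a b r :: real
    and xbar :: "nat \<Rightarrow> 'w \<Rightarrow> real ^ 'n"
  assumes Xs: "\<And>i. Xs i \<subseteq> range (block \<beta> i)" "\<And>i. Xs i \<noteq> {}" "\<And>i. closed (Xs i)" "\<And>i. convex (Xs i)"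
    and X: "X = block_prod \<beta> Xs"
    and f_C1: "\<And>x. GDERIV f x :> g x" "continuous_on UNIV g"
    and f_sc: "\<mu> > 0" "strongly_convex_on \<mu> X f g"
    and f_lip: "L_f > 0" "L_f-lipschitz_on X g"
    and F_mono: "continuous_on X F" "vi_monotone_on X F"
    and F_growth: "L_F \<ge> 0" "B_F \<ge> 0"
      "\<And>x y. x \<in> X \<Longrightarrow> y \<in> X \<Longrightarrow> (norm (F x - F y))\<^sup>2 \<le> L_F\<^sup>2 * (norm (x - y))\<^sup>2 + B_F"
    and SOL: "SOL X F \<noteq> {}"
    and xstar: "xstar = arg_min_on f (SOL X F)"
    and M: "prob_space M"
    and x0: "x0 \<in> borel_measurable M" "\<And>\<omega>. \<omega> \<in> space M \<Longrightarrow> x0 \<omega> \<in> X"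
    and ix_indep: "prob_space.indep_vars M (\<lambda>_. count_space UNIV) ix UNIV"
    and ix_unif: "\<And>k. distr M (count_space UNIV) (ix k) = uniform_count_measure UNIV"
    and ix_history: "\<And>k. indep_rv M
          (borel \<Otimes>\<^sub>M PiM {..<k} (\<lambda>_. count_space UNIV)) (\<lambda>\<omega>. (x0 \<omega>, \<lambda>j\<in>{..<k}. ix j \<omega>))
          (count_space UNIV) (ix k)"
    and params: "\<gamma>0 > 0" "\<eta>0 > 0" "0 < b" "b < 1/2" "1/2 < a" "a + b < 1"
    and \<gamma>: "\<And>k. \<gamma> k = \<gamma>0 * (real k + 1) powr (- a)"
    and \<eta>: "\<And>k. \<eta> k = \<eta>0 * (real k + 1) powr (- b)"
    and r: "0 \<le> r" "r < 1"
    and xbar: "\<And>k \<omega>. xbar k \<omega> =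
          weighted_avg \<gamma> r (aRB_iter \<beta> Xs F g \<gamma> \<eta> (x0 \<omega>) (\<lambda>j. ix j \<omega>)) k"
  shows "(AE \<omega> in M. (\<lambda>k. xbar k \<omega>) \<longlonglongrightarrow> xstar)
    \<and> (integrable M x0 \<longrightarrow>
         (\<forall>k. integrable M (\<lambda>\<omega>. norm (xbar k \<omega> - xstar))) \<and>
         (\<lambda>k. prob_space.expectation M (\<lambda>\<omega>. norm (xbar k \<omega> - xstar))) \<longlonglongrightarrow> 0)"
proof -
  interpret prob_space M by (rule M)

  \<comment> \<open>Notation and elementary properties of the data\<close>
  define d where "d = real CARD('d)"
  define C where "C = 2 * L_F\<^sup>2 + 2 * \<eta>0\<^sup>2 * L_f\<^sup>2"
  define t where "t k = \<gamma> k * \<eta> k * \<mu> / d" for k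
  define G where "G k x = F x + \<eta> k *\<^sub>R g x" for k x
  define y where "y k = (SOME z. z \<in> SOL X (G k))" for k
  define \<theta> where "\<theta> k = 4 * (\<gamma> k)\<^sup>2 * B_F / d + 3 / t k * (norm (y k - y (Suc k)))\<^sup>2" for k
  define x where "x k \<omega> = aRB_iter \<beta> Xs F g \<gamma> \<eta> (x0 \<omega>) (\<lambda>j. ix j \<omega>) k" for k \<omega>
  define e where "e k \<omega> = (norm (x k \<omega> - y k))\<^sup>2" for k \<omega>
  \<comment> \<open>The value that \<open>e (Suc k)\<close> takes if block \<open>i\<close> is
    drawn; a function of the past before that draw.\<close>
  define \<phi> where "\<phi> k i \<omega> = (norm (aRB_step \<beta> Xs (G k) (\<gamma> k) i (x k \<omega>) - y (Suc k)))\<^sup>2" for k i \<omega>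
  have d: "0 < d" by (simp add: d_def)
  have C: "0 \<le> C" by (simp add: C_def)
  have \<gamma>_pos: "0 < \<gamma> k" and \<eta>_pos: "0 < \<eta> k" for k
    using params by (simp_all add: \<gamma> \<eta>)
  have \<eta>_le: "\<eta> k \<le> \<eta>0" for k
  proof -
    have "(real k + 1) powr (- b) \<le> (real k + 1) powr 0"
      using params by (intro powr_mono) auto
    then show ?thesis using params by (simp add: \<eta>)
  qed
  have t_pos: "0 < t k" for k using \<gamma>_pos \<eta>_pos f_sc(1) d by (simp add: t_def)
  have closed_X: "closed X" and convex_X: "convex X"
    unfolding X by (intro closed_block_prod convex_block_prod Xs)+
  have cont_g: "continuous_on X g" using f_C1(2) by (rule continuous_on_subset) simp
  have cont_f: "continuous_on X f"
    using f_C1(1) unfolding gderiv_def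
    by (intro continuous_at_imp_continuous_on ballI) (blast intro: has_derivative_continuous)
  have cont_G: "continuous_on X (G k)" for k
    unfolding G_def by (intro continuous_intros F_mono cont_g)
  note g_mono = strongly_convex_on_gradient_strongly_monotone[OF f_sc(2)]
  have powr_lim: "(\<lambda>k. c * (real k + 1) powr p) \<longlonglongrightarrow> 0" if "p < 0" for c p
  proof (rule tendsto_mult_right_zero)
    show "(\<lambda>k. (real k + 1) powr p) \<longlonglongrightarrow> 0"
      using filterlim_tendsto_add_at_top[OF tendsto_const[of "1::real"] filterlim_real_sequentially]
      by (intro tendsto_neg_powr that) (simp add: add.commute)
  qed
  have \<eta>_lim: "\<eta> \<longlonglongrightarrow> 0"
    unfolding \<eta>[abs_def] using params by (intro powr_lim) simp

  \<comment> \<open>The Tikhonov trajectory and its drift\<close>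
  have y_SOL: "y k \<in> SOL X (G k)" for k
  proof -
    have "SOL X (G k) \<noteq> {}"
      unfolding G_def
      by (rule Tikhonov_exists[OF closed_X convex_X F_mono(1) cont_g F_mono(2) g_mono f_sc(1) \<eta>_pos SOL])
    then show ?thesis unfolding y_def by (simp add: some_in_eq)
  qed
  then have y_SOL': "y k \<in> SOL X (\<lambda>x. F x + \<eta> k *\<^sub>R g x)" for k
    unfolding G_def .
  have yX: "y k \<in> X" for k using y_SOL[of k] by (simp add: SOL_def)
  have y_lim: "y \<longlonglongrightarrow> xstar"
    unfolding xstar
    by (rule Tikhonov_limit[OF closed_X F_mono(1) cont_g cont_f F_mono(2) f_sc \<eta>_pos \<eta>_lim SOL y_SOL'])
  \<comment> \<open>Gradients along the convergent trajectory are bounded, which makes the drift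
    estimate uniform in \<open>k\<close>.\<close>
  have "(\<lambda>k. g (y k)) \<longlonglongrightarrow> g xstar"
    using continuous_on_tendsto_compose[OF f_C1(2) y_lim] by simp
  then have "Bseq (\<lambda>k. g (y k))" by (intro convergent_imp_Bseq convergentI)
  then obtain Mg where Mg: "\<And>k. norm (g (y k)) \<le> Mg" unfolding Bseq_def by blast
  have y_diff: "norm (y k - y (Suc k)) \<le> Mg / \<mu> / (real k + 1)" for k
  proof -
    have "\<eta> (Suc k) * \<mu> * norm (y k - y (Suc k)) \<le> \<bar>\<eta> k - \<eta> (Suc k)\<bar> * norm (g (y k))"
      by (rule Tikhonov_lipschitz[OF F_mono(2) g_mono \<eta>_pos y_SOL' y_SOL'])
    also have "\<dots> \<le> (\<eta> (Suc k) / (real k + 1)) * Mg"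
    proof (rule mult_mono)
      \<comment> \<open>The ratio of consecutive \<open>\<eta>\<close> is \<open>q powr b\<close>,
        which lies between \<open>1\<close> and \<open>q\<close> since \<open>0 < b < 1\<close>; the
        relative decrease of \<open>\<eta>\<close> is thus at most
        \<open>1 / (k + 1)\<close>.\<close>
      define q where "q = (real k + 2) / (real k + 1)"
      have q: "1 \<le> q" "q = 1 + 1 / (real k + 1)" by (auto simp: q_def field_simps)
      have "\<eta> k = \<eta> (Suc k) * q powr b"
      proof -
        have "(real k + 1) powr - b = (real k + 2) powr - b * q powr b"
          unfolding q_def by (simp add: powr_divide powr_minus field_simps)
        then show ?thesis by (simp add: \<eta> add.commute)
      qed
      moreover have "1 \<le> q powr b" using q params by (simp add: ge_one_powr_ge_zero)
      moreover have "q powr b \<le> q powr 1" using q params by (intro powr_mono) auto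
      ultimately have "\<eta> (Suc k) * 1 \<le> \<eta> k" "\<eta> k \<le> \<eta> (Suc k) * (1 + 1 / (real k + 1))"
        using \<eta>_pos[of "Suc k"] q by (auto intro!: mult_left_mono)
      then show "\<bar>\<eta> k - \<eta> (Suc k)\<bar> \<le> \<eta> (Suc k) / (real k + 1)"
        by (simp add: algebra_simps)
    qed (use Mg \<eta>_pos in \<open>auto intro: less_imp_le\<close>)
    finally have "\<eta> (Suc k) * (\<mu> * norm (y k - y (Suc k))) \<le> \<eta> (Suc k) * (Mg / (real k + 1))"
      by (simp add: mult.assoc)
    then have "\<mu> * norm (y k - y (Suc k)) \<le> Mg / (real k + 1)"
      using \<eta>_pos by (rule mult_left_le_imp_le)
    then have "norm (y k - y (Suc k)) \<le> Mg / (real k + 1) / \<mu>"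
      using f_sc(1) by (simp only: pos_le_divide_eq mult.commute)
    then show ?thesis by (simp add: mult.commute)
  qed

  \<comment> \<open>Step factors and errors of the recursion as power series in the iteration
    number\<close>
  have t_eq: "t k = \<gamma>0 * \<eta>0 * \<mu> / d * (real k + 1) powr (- (a + b))" for k
    using powr_add[of "real k + 1" "- a" "- b"] by (simp add: t_def \<gamma> \<eta>)
  have \<gamma>2_eq: "(\<gamma> k)\<^sup>2 = \<gamma>0\<^sup>2 * (real k + 1) powr (- (2 * a))" for k
    using powr_add[of "real k + 1" "- a" "- a"] by (simp add: \<gamma> power2_eq_square)
  have t_not_summable: "\<not> summable t"
  proof
    assume "summable t"
    then have "summable (\<lambda>k. d / (\<gamma>0 * \<eta>0 * \<mu>) * t k)" by (rule summable_mult)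
    moreover have "d / (\<gamma>0 * \<eta>0 * \<mu>) * t k = (real k + 1) powr (- (a + b))" for k
      using d params f_sc(1) by (simp add: t_eq)
    ultimately have "summable (\<lambda>k. (real k + 1) powr (- (a + b)))" by (simp only:)
    then show False using params by (simp add: summable_add1_powr_iff)
  qed
  have \<theta>_summable: "summable \<theta>"
  proof (rule summable_comparison_test')
    \<comment> \<open>The first exponent is below \<open>-1\<close> since \<open>a > 1/2\<close>.
      The second, from the squared drift \<open>1/k\<^sup>2\<close> divided by \<open>t k\<close>,
      is below \<open>-1\<close> since \<open>a + b < 1\<close>.\<close>
    show "summable (\<lambda>k. 4 * \<gamma>0\<^sup>2 * B_F / d * (real k + 1) powr (- (2 * a))
        + 3 * d / (\<gamma>0 * \<eta>0 * \<mu>) * (Mg / \<mu>)\<^sup>2 * (real k + 1) powr (a + b - 2))"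
      using params by (intro summable_add summable_mult) (simp_all add: summable_add1_powr_iff)
    fix k :: nat
    have "3 / t k * (norm (y k - y (Suc k)))\<^sup>2 \<le> 3 / t k * (Mg / \<mu> / (real k + 1))\<^sup>2"
      using t_pos[of k] y_diff by (intro mult_left_mono power_mono) auto
    also have "\<dots> = 3 * d / (\<gamma>0 * \<eta>0 * \<mu>) * (Mg / \<mu>)\<^sup>2 * (real k + 1) powr (a + b - 2)"
    proof -
      have "(real k + 1) powr (a + b - 2) * ((real k + 1) powr (- a - b) * (real k + 1) powr 2) = 1"
        by (simp only: powr_add[symmetric]) simp
      then have "(real k + 1) powr (a + b - 2) * ((real k + 1) powr (- a - b) * (real k + 1)\<^sup>2) = 1"
        by (simp add: powr_numeral)
      then show ?thesis
        by (simp add: t_eq power_divide divide_simps)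
    qed
    finally show "norm (\<theta> k) \<le> 4 * \<gamma>0\<^sup>2 * B_F / d * (real k + 1) powr (- (2 * a))
        + 3 * d / (\<gamma>0 * \<eta>0 * \<mu>) * (Mg / \<mu>)\<^sup>2 * (real k + 1) powr (a + b - 2)"
      using t_pos[of k] F_growth(2) d by (simp add: \<theta>_def \<gamma>2_eq mult_ac)
  qed
  have \<theta>_nonneg: "0 \<le> \<theta> k" for k
    using t_pos[of k] F_growth(2) d by (simp add: \<theta>_def)
  have "\<forall>\<^sub>F k in sequentially. t k < 1"
  proof (rule order_tendstoD)
    show "t \<longlonglongrightarrow> 0"
      unfolding t_eq[abs_def] using params by (intro powr_lim) simp
  qed simp
  \<comment> \<open>After division by \<open>(k + 1) powr (- (a + b))\<close>, the growth condition
    on the steps compares a multiple of \<open>(k + 1) powr (b - a)\<close>, which vanishes because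
    \<open>b < 1/2 < a\<close>, with a positive constant.\<close>
  moreover have "\<forall>\<^sub>F k in sequentially. \<gamma>0\<^sup>2 * C / d * (real k + 1) powr (b - a) < \<gamma>0 * \<eta>0 * \<mu> / d / 2"
  proof (rule order_tendstoD)
    show "(\<lambda>k. \<gamma>0\<^sup>2 * C / d * (real k + 1) powr (b - a)) \<longlonglongrightarrow> 0"
      using params by (intro powr_lim) simp
    show "0 < \<gamma>0 * \<eta>0 * \<mu> / d / 2" using params f_sc d by simp
  qed
  ultimately have "\<forall>\<^sub>F k in sequentially. t k \<le> 1 \<and> (\<gamma> k)\<^sup>2 * C / d \<le> t k / 2"
  proof eventually_elim
    case (elim k)
    have "(real k + 1) powr (- (2 * a)) = (real k + 1) powr (b - a) * (real k + 1) powr (- (a + b))"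
      by (simp add: powr_add[symmetric])
    then have "(\<gamma> k)\<^sup>2 * C / d = (\<gamma>0\<^sup>2 * C / d * (real k + 1) powr (b - a)) * (real k + 1) powr (- (a + b))"
      by (simp add: \<gamma>2_eq)
    also have "\<dots> \<le> (\<gamma>0 * \<eta>0 * \<mu> / d / 2) * (real k + 1) powr (- (a + b))"
      using elim by (intro mult_right_mono) auto
    finally show ?case using elim by (simp add: t_eq)
  qed
  then obtain K where K: "\<And>k. K \<le> k \<Longrightarrow> t k \<le> 1" "\<And>k. K \<le> k \<Longrightarrow> (\<gamma> k)\<^sup>2 * C / d \<le> t k / 2"
    by (auto simp: eventually_sequentially)

  \<comment> \<open>The iterates: feasibility, growth and measurability with respect to the
    past\<close>
  have x_0: "x 0 \<omega> = x0 \<omega>" for \<omega> by (simp add: x_def)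
  have x_Suc: "x (Suc k) \<omega> = aRB_step \<beta> Xs (G k) (\<gamma> k) (ix k \<omega>) (x k \<omega>)" for k \<omega>
    unfolding x_def aRB_iter_Suc[OF Xs(1-3)] G_def ..
  have xX: "x k \<omega> \<in> X" if "\<omega> \<in> space M" for k \<omega>
    by (induction k) (use that x0 X in \<open>auto simp: x_0 x_Suc intro!: aRB_step_in_block_prod Xs\<close>)
  have growth: "(norm (G k v - G k (y k)))\<^sup>2 \<le> C * (norm (v - y k))\<^sup>2 + 2 * B_F" if "v \<in> X" for k v
    unfolding G_def C_def
  proof (rule regularized_growth[OF F_growth(3)[OF that yX] _ less_imp_le[OF \<eta>_pos] \<eta>_le])
    show "norm (g v - g (y k)) \<le> L_f * norm (v - y k)"
      using lipschitz_onD[OF f_lip(2) that yX] by (simp add: dist_norm)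
  qed
  define H where "H = history M x0 ix"
  have hist: "(\<lambda>\<omega>. (x0 \<omega>, \<lambda>j\<in>{..<k}. ix j \<omega>)) \<in> measurable M (borel \<Otimes>\<^sub>M PiM {..<k} (\<lambda>_. count_space UNIV))" for k
    using ix_history[of k] by (simp add: indep_rv_def)
  have H_sub: "subalgebra M (H k)" for k unfolding H_def by (rule subalgebra_history[OF hist])
  have H_space: "space (H k) = space M" for k by (simp add: H_def)
  have ix_M: "ix k \<in> measurable M (count_space UNIV)" for k
    using ix_history[of k] by (simp add: indep_rv_def)
  have step_meas: "(\<lambda>\<omega>. aRB_step \<beta> Xs (G k) (\<gamma> k) i (x k \<omega>)) \<in> borel_measurable N"
    if "x k \<in> borel_measurable N" "space N = space M" for k i N
  proof (rule measurable_aRB_step)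
    show "continuous_on X (G k)" by (rule cont_G)
    show "\<And>\<omega>. \<omega> \<in> space N \<Longrightarrow> x k \<omega> \<in> X" using xX that(2) by simp
  qed (fact Xs that(1))+
  \<comment> \<open>The claim covers all later histories so that the induction can stay within one
    fixed \<open>H m\<close>. The new iterate uses \<open>ix k\<close> with \<open>k < m\<close>,
    and measurability follows by splitting over the finitely many values of that index.\<close>
  have x_meas: "x k \<in> borel_measurable (H m)" if "k \<le> m" for k m
    using that
  proof (induction k)
    case 0
    then show ?case by (simp add: x_0[abs_def] H_def measurable_history_initial)
  next
    case (Suc k)
    show ?case
      unfolding x_Suc[abs_def]
    proof (rule measurable_compose_countable'[where I = UNIV and g = "ix k"
          and f = "\<lambda>i \<omega>. aRB_step \<beta> Xs (G k) (\<gamma> k) i (x k \<omega>)"])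
      show "ix k \<in> measurable (H m) (count_space UNIV)"
        unfolding H_def using Suc.prems by (intro measurable_history_index) simp
      show "(\<lambda>\<omega>. aRB_step \<beta> Xs (G k) (\<gamma> k) i (x k \<omega>)) \<in> borel_measurable (H m)" for i
        using Suc by (intro step_meas H_space) simp
    qed auto
  qed
  have x_M [measurable]: "x k \<in> borel_measurable M" for k
    using measurable_from_subalg[OF H_sub x_meas] by blast
  have e_meas: "e k \<in> borel_measurable (H k)" for k
    using x_meas[of k k] unfolding e_def by measurable
  have \<phi>_meas: "\<phi> k i \<in> borel_measurable (H k)" for k i
  proof -
    have [measurable]: "(\<lambda>\<omega>. aRB_step \<beta> Xs (G k) (\<gamma> k) i (x k \<omega>)) \<in> borel_measurable (H k)"
      by (intro step_meas x_meas H_space) simp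
    show ?thesis unfolding \<phi>_def by measurable
  qed
  \<comment> \<open>The weight \<open>w\<close> compensates for a possibly infinite second moment of \<open>x0\<close>.\<close>
  have weighted: "(\<forall>k. integrable M (\<lambda>\<omega>. w (x0 \<omega>) * e k \<omega>)) \<and>
      (\<lambda>k. expectation (\<lambda>\<omega>. w (x0 \<omega>) * e k \<omega>)) \<longlonglongrightarrow> 0 \<and>
      (AE \<omega> in M. (\<lambda>k. w (x0 \<omega>) * e k \<omega>) \<longlonglongrightarrow> 0)"
    if w: "w \<in> borel_measurable borel" "\<And>v. 0 \<le> w v" "\<And>v. w v \<le> 1"
      and int0: "integrable M (\<lambda>\<omega>. w (x0 \<omega>) * e 0 \<omega>)" for w :: "real ^ 'n \<Rightarrow> real"
  proof -
    have prob_H: "prob (A \<inter> {\<omega>\<in>space M. ix k \<omega> = i}) = prob A / real CARD('d)" if "A \<in> sets (H k)" for k A i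
      using prob_history_index[OF ix_history ix_unif] that unfolding H_def by blast
    have mono_H: "sets (H j) \<subseteq> sets (H k)" if "j \<le> k" for j k
      unfolding H_def by (rule sets_history_mono[OF that])
    have crude: "\<phi> k i \<omega> \<le> (4 + 4 * (\<gamma> k)\<^sup>2 * C + 4 * (\<gamma> k)\<^sup>2 * (2 * B_F) + 2 * (norm (y k - y (Suc k)))\<^sup>2) * (e k \<omega> + 1)"
      if "\<omega> \<in> space M" for k i \<omega>
      unfolding \<phi>_def e_def
      using y_SOL[of k, unfolded X] growth[OF xX[OF that]] F_growth(2) C \<gamma>_pos[of k]
      by (intro aRB_step_dist_crude Xs) (auto intro: less_imp_le)
    have rec: "(\<Sum>i\<in>UNIV. \<phi> k i \<omega>) / real CARD('d) \<le> (1 - t k) * e k \<omega> + \<theta> k"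
      if k: "K \<le> k" and \<omega>: "\<omega> \<in> space M" for k \<omega>
      unfolding \<phi>_def e_def \<theta>_def d_def G_def
    proof (rule aRB_step_mean_recursion[OF Xs])
      show "y k \<in> SOL (block_prod \<beta> Xs) (\<lambda>x. F x + \<eta> k *\<^sub>R g x)" using y_SOL' unfolding X .
      show "0 \<le> (F (x k \<omega>) - F (y k)) \<bullet> (x k \<omega> - y k)"
        using F_mono(2) xX[OF \<omega>] yX by (auto simp: vi_monotone_on_def)
      show "\<mu> * (norm (x k \<omega> - y k))\<^sup>2 \<le> (g (x k \<omega>) - g (y k)) \<bullet> (x k \<omega> - y k)"
        by (rule g_mono[OF xX[OF \<omega>] yX])
      show "(norm (F (x k \<omega>) + \<eta> k *\<^sub>R g (x k \<omega>) - (F (y k) + \<eta> k *\<^sub>R g (y k))))\<^sup>2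
          \<le> C * (norm (x k \<omega> - y k))\<^sup>2 + 2 * B_F"
        using growth[OF xX[OF \<omega>], of k] unfolding G_def .
      show "t k = \<gamma> k * \<eta> k * \<mu> / real CARD('d)" by (simp add: t_def d_def)
      show "(\<gamma> k)\<^sup>2 * C / real CARD('d) \<le> t k / 2" using K(2)[OF k] by (simp add: d_def)
    qed (fact F_growth f_sc(1) \<gamma>_pos \<eta>_pos K(1)[OF k])+
    have W: "(\<lambda>\<omega>. w (x0 \<omega>)) \<in> borel_measurable (H 0)"
      using x_meas[of 0 0] by (intro measurable_compose[OF _ w(1)]) (simp add: x_0[abs_def])
    have W_int: "integrable M (\<lambda>\<omega>. w (x0 \<omega>))"
      using w measurable_from_subalg[OF H_sub W] by (intro integrable_const_bound[of _ 1]) auto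
    have e_Suc: "e (Suc k) \<omega> = \<phi> k (ix k \<omega>) \<omega>" for k \<omega>
      by (simp add: e_def \<phi>_def x_Suc)
    have e_nonneg: "0 \<le> e k \<omega>" and \<phi>_nonneg: "0 \<le> \<phi> k i \<omega>" for k i \<omega>
      by (simp_all add: e_def \<phi>_def)
    note R = random_index_recursion[where W = "\<lambda>\<omega>. w (x0 \<omega>)", OF H_sub mono_H ix_M prob_H e_meas e_nonneg
        \<phi>_meas \<phi>_nonneg e_Suc crude rec less_imp_le[OF t_pos] t_not_summable \<theta>_nonneg \<theta>_summable W w(2) W_int int0]
    show ?thesis using R by blast
  qed

  \<comment> \<open>Divergence of the averaging weights\<close>
  have avg_not_summable: "\<not> summable (\<lambda>k. \<gamma> k powr r)"
  proof
    assume "summable (\<lambda>k. \<gamma> k powr r)"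
    then have "summable (\<lambda>k. (1 / \<gamma>0 powr r) * \<gamma> k powr r)" by (rule summable_mult)
    moreover have "(1 / \<gamma>0 powr r) * \<gamma> k powr r = (real k + 1) powr (- a * r)" for k
      using params by (simp add: \<gamma> powr_mult powr_powr)
    ultimately have "summable (\<lambda>k. (real k + 1) powr (- a * r))" by (simp only:)
    then have "1 < a * r" by (simp add: summable_add1_powr_iff)
    \<comment> \<open>\<open>a < 1\<close> follows from \<open>a + b < 1\<close> and
      \<open>0 < b\<close>.\<close>
    moreover have "a * r \<le> 1 * 1" using params r by (intro mult_mono) auto
    ultimately show False by simp
  qed
  have xbar_eq: "xbar k \<omega> = weighted_avg \<gamma> r (\<lambda>j. x j \<omega>) k" for k \<omega>
    by (simp add: xbar x_def[abs_def])
  have e0_le: "e 0 \<omega> \<le> 2 * (norm (x0 \<omega>))\<^sup>2 + 2 * (norm (y 0))\<^sup>2" for \<omega>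
    using norm_add_square_le[of 1 "x0 \<omega>" "- y 0"] by (simp add: e_def x_0)
  have e0_M [measurable]: "e 0 \<in> borel_measurable M" unfolding e_def by measurable
  note [measurable] = x0(1)

  \<comment> \<open>Almost sure convergence\<close>
  have "AE \<omega> in M. (\<lambda>k. xbar k \<omega>) \<longlonglongrightarrow> xstar"
  proof -
    define w :: "real ^ 'n \<Rightarrow> real" where "w v = 1 / (1 + (norm v)\<^sup>2)" for v
    have w_pos: "0 < w v" for v by (simp add: w_def add_pos_nonneg)
    have [measurable]: "w \<in> borel_measurable borel" unfolding w_def by measurable
    \<comment> \<open>\<open>e 0\<close> grows at most quadratically in
      \<open>norm (x0 \<omega>)\<close>, so the weighted value is bounded whatever the law of
      \<open>x0\<close>.\<close>
    have "integrable M (\<lambda>\<omega>. w (x0 \<omega>) * e 0 \<omega>)"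
    proof (rule integrable_const_bound[of _ "2 + 2 * (norm (y 0))\<^sup>2"])
      have "w (x0 \<omega>) * e 0 \<omega> \<le> 2 + 2 * (norm (y 0))\<^sup>2" for \<omega>
      proof -
        have "e 0 \<omega> \<le> (2 + 2 * (norm (y 0))\<^sup>2) * (1 + (norm (x0 \<omega>))\<^sup>2)"
        proof -
          have "0 \<le> (norm (x0 \<omega>))\<^sup>2 * (norm (y 0))\<^sup>2" by simp
          moreover have "(2 + 2 * (norm (y 0))\<^sup>2) * (1 + (norm (x0 \<omega>))\<^sup>2)
              = 2 + 2 * (norm (x0 \<omega>))\<^sup>2 + 2 * (norm (y 0))\<^sup>2 + 2 * ((norm (x0 \<omega>))\<^sup>2 * (norm (y 0))\<^sup>2)"
            by (simp add: algebra_simps)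
          ultimately show ?thesis using e0_le[of \<omega>] by linarith
        qed
        moreover have "0 < 1 + (norm (x0 \<omega>))\<^sup>2" by (simp add: add_pos_nonneg)
        ultimately show ?thesis by (simp add: w_def pos_divide_le_eq)
      qed
      moreover have "0 \<le> w (x0 \<omega>) * e 0 \<omega>" for \<omega>
        using w_pos[of "x0 \<omega>"] by (simp add: e_def)
      ultimately show "AE \<omega> in M. norm (w (x0 \<omega>) * e 0 \<omega>) \<le> 2 + 2 * (norm (y 0))\<^sup>2" by simp
    qed measurable
    then have "AE \<omega> in M. (\<lambda>k. w (x0 \<omega>) * e k \<omega>) \<longlonglongrightarrow> 0"
      using weighted[of w] w_pos by (auto simp: w_def less_imp_le)
    then show ?thesis
    proof eventually_elim
      case (elim \<omega>)
      \<comment> \<open>Along a fixed path the weight is a positive constant and can be divided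
        out.\<close>
      have "(\<lambda>k. 1 / w (x0 \<omega>) * (w (x0 \<omega>) * e k \<omega>)) \<longlonglongrightarrow> 0"
        by (rule tendsto_mult_right_zero[OF elim])
      then have e_lim: "(\<lambda>k. e k \<omega>) \<longlonglongrightarrow> 0" using w_pos[of "x0 \<omega>"] by simp
      have "(\<lambda>k. sqrt (e k \<omega>)) \<longlonglongrightarrow> 0" using tendsto_real_sqrt[OF e_lim] by simp
      then have "(\<lambda>k. x k \<omega> - y k) \<longlonglongrightarrow> 0" by (simp add: e_def tendsto_norm_zero_iff)
      from tendsto_add[OF this y_lim] have "(\<lambda>k. x k \<omega>) \<longlonglongrightarrow> xstar" by simp
      then show ?case unfolding xbar_eq by (rule weighted_avg_tendsto[OF \<gamma>_pos avg_not_summable])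
    qed
  qed

  \<comment> \<open>Convergence in mean\<close>
  moreover have "(\<forall>k. integrable M (\<lambda>\<omega>. norm (xbar k \<omega> - xstar))) \<and>
         (\<lambda>k. expectation (\<lambda>\<omega>. norm (xbar k \<omega> - xstar))) \<longlonglongrightarrow> 0" if x0_int: "integrable M x0"
  proof -
    define w :: "real ^ 'n \<Rightarrow> real" where "w v = 1 / (1 + norm v)" for v
    have w_pos: "0 < w v" for v by (simp add: w_def add_pos_nonneg)
    have [measurable]: "w \<in> borel_measurable borel" unfolding w_def by measurable
    \<comment> \<open>This weaker weight leaves linear growth in \<open>norm (x0 \<omega>)\<close>,
      which is integrable here; its reciprocal is integrable too, as the passage to first moments
      demands.\<close>
    have "integrable M (\<lambda>\<omega>. w (x0 \<omega>) * e 0 \<omega>)"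
    proof (rule Bochner_Integration.integrable_bound)
      show "integrable M (\<lambda>\<omega>. 2 * norm (x0 \<omega>) + 2 * (norm (y 0))\<^sup>2)" using x0_int by auto
      have "w (x0 \<omega>) * e 0 \<omega> \<le> 2 * norm (x0 \<omega>) + 2 * (norm (y 0))\<^sup>2" for \<omega>
      proof -
        have "e 0 \<omega> \<le> (2 * norm (x0 \<omega>) + 2 * (norm (y 0))\<^sup>2) * (1 + norm (x0 \<omega>))"
        proof -
          have "0 \<le> norm (x0 \<omega>)" "0 \<le> norm (x0 \<omega>) * (norm (y 0))\<^sup>2" by simp_all
          moreover have "(2 * norm (x0 \<omega>) + 2 * (norm (y 0))\<^sup>2) * (1 + norm (x0 \<omega>))
              = 2 * norm (x0 \<omega>) + 2 * (norm (x0 \<omega>))\<^sup>2 + 2 * (norm (y 0))\<^sup>2 + 2 * (norm (x0 \<omega>) * (norm (y 0))\<^sup>2)"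
            by (simp add: algebra_simps power2_eq_square)
          ultimately show ?thesis using e0_le[of \<omega>] by linarith
        qed
        moreover have "0 < 1 + norm (x0 \<omega>)" by (simp add: add_pos_nonneg)
        ultimately show ?thesis by (simp add: w_def pos_divide_le_eq)
      qed
      moreover have "0 \<le> w (x0 \<omega>) * e 0 \<omega>" for \<omega>
        using w_pos[of "x0 \<omega>"] by (simp add: e_def)
      ultimately show "AE \<omega> in M. norm (w (x0 \<omega>) * e 0 \<omega>) \<le> norm (2 * norm (x0 \<omega>) + 2 * (norm (y 0))\<^sup>2)"
        by simp
    qed measurable
    then have we: "(\<forall>k. integrable M (\<lambda>\<omega>. w (x0 \<omega>) * e k \<omega>)) \<and>
      (\<lambda>k. expectation (\<lambda>\<omega>. w (x0 \<omega>) * e k \<omega>)) \<longlonglongrightarrow> 0"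
      using weighted[of w] w_pos by (auto simp: w_def less_imp_le)
    have xy: "integrable M (\<lambda>\<omega>. norm (x k \<omega> - y k))" "(\<lambda>k. expectation (\<lambda>\<omega>. norm (x k \<omega> - y k))) \<longlonglongrightarrow> 0" for k
      using we x0_int unfolding w_def e_def
      by (auto intro!: expectation_tendsto_zero_weighted[of "\<lambda>k \<omega>. norm (x k \<omega> - y k)" "\<lambda>\<omega>. 1 + norm (x0 \<omega>)"])
    have x_int: "integrable M (\<lambda>\<omega>. norm (x k \<omega> - xstar))" for k
    proof (rule Bochner_Integration.integrable_bound)
      show "integrable M (\<lambda>\<omega>. norm (x k \<omega> - y k) + norm (y k - xstar))" using xy(1) by auto
      show "AE \<omega> in M. norm (norm (x k \<omega> - xstar)) \<le> norm (norm (x k \<omega> - y k) + norm (y k - xstar))"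
        using norm_triangle_ineq[of "x k _ - y k" "y k - xstar"] by simp
    qed measurable
    have "(\<lambda>k. expectation (\<lambda>\<omega>. norm (x k \<omega> - xstar))) \<longlonglongrightarrow> 0"
    proof (rule tendsto_sandwich[of "\<lambda>_. 0"])
      show "(\<lambda>k. expectation (\<lambda>\<omega>. norm (x k \<omega> - y k)) + norm (y k - xstar)) \<longlonglongrightarrow> 0"
        using tendsto_add[OF xy(2) tendsto_norm_zero[OF LIM_zero[OF y_lim]]] by simp
      show "\<forall>\<^sub>F k in sequentially. expectation (\<lambda>\<omega>. norm (x k \<omega> - xstar))
          \<le> expectation (\<lambda>\<omega>. norm (x k \<omega> - y k)) + norm (y k - xstar)"
      proof (intro always_eventually allI)
        fix k
        have "expectation (\<lambda>\<omega>. norm (x k \<omega> - xstar)) \<le> expectation (\<lambda>\<omega>. norm (x k \<omega> - y k) + norm (y k - xstar))"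
          using xy(1) norm_triangle_ineq[of "x k _ - y k" "y k - xstar"]
          by (intro integral_mono x_int) auto
        then show "expectation (\<lambda>\<omega>. norm (x k \<omega> - xstar))
            \<le> expectation (\<lambda>\<omega>. norm (x k \<omega> - y k)) + norm (y k - xstar)"
          using xy(1)[of k] by (simp add: prob_space)
      qed
    qed (auto intro!: always_eventually integral_nonneg_AE)
    then have mean: "(\<lambda>k. (\<Sum>j\<le>k. \<gamma> j powr r * expectation (\<lambda>\<omega>. norm (x j \<omega> - xstar))) / (\<Sum>j\<le>k. \<gamma> j powr r)) \<longlonglongrightarrow> 0"
      using \<gamma>_pos avg_not_summable by (intro weighted_mean_tendsto_zero) (auto simp: less_imp_neq[symmetric])
    \<comment> \<open>From here on \<open>b\<close> denotes this random majorant of the averaged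
      error and no longer the exponent.\<close>
    define b where "b k \<omega> = (\<Sum>j\<le>k. \<gamma> j powr r * norm (x j \<omega> - xstar)) / (\<Sum>j\<le>k. \<gamma> j powr r)" for k \<omega>
    have b_int: "integrable M (b k)" for k
      unfolding b_def by (intro integrable_divide_zero Bochner_Integration.integrable_sum integrable_mult_right x_int)
    have xbar_le: "norm (xbar k \<omega> - xstar) \<le> b k \<omega>" for k \<omega>
      unfolding xbar_eq b_def by (rule norm_weighted_avg_diff_le[OF \<gamma>_pos])
    have xbar_M [measurable]: "xbar k \<in> borel_measurable M" for k
      unfolding xbar_eq[abs_def] weighted_avg_eq[OF \<gamma>_pos] by measurable
    have xbar_int: "integrable M (\<lambda>\<omega>. norm (xbar k \<omega> - xstar))" for k
      by (rule Bochner_Integration.integrable_bound[OF b_int[of k]])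
         (measurable, use xbar_le in \<open>auto intro!: AE_I2 order_trans[OF _ abs_ge_self]\<close>)
    have "(\<lambda>k. expectation (\<lambda>\<omega>. norm (xbar k \<omega> - xstar))) \<longlonglongrightarrow> 0"
    proof (rule tendsto_sandwich[OF _ _ tendsto_const mean])
      show "\<forall>\<^sub>F k in sequentially. expectation (\<lambda>\<omega>. norm (xbar k \<omega> - xstar))
          \<le> (\<Sum>j\<le>k. \<gamma> j powr r * expectation (\<lambda>\<omega>. norm (x j \<omega> - xstar))) / (\<Sum>j\<le>k. \<gamma> j powr r)"
      proof (intro always_eventually allI)
        fix k
        have "expectation (\<lambda>\<omega>. norm (xbar k \<omega> - xstar)) \<le> expectation (b k)"
          by (intro integral_mono xbar_int b_int xbar_le)
        also have "\<dots> = (\<Sum>j\<le>k. \<gamma> j powr r * expectation (\<lambda>\<omega>. norm (x j \<omega> - xstar))) / (\<Sum>j\<le>k. \<gamma> j powr r)"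
          unfolding b_def using x_int by (simp add: Bochner_Integration.integral_sum)
        finally show "expectation (\<lambda>\<omega>. norm (xbar k \<omega> - xstar))
          \<le> (\<Sum>j\<le>k. \<gamma> j powr r * expectation (\<lambda>\<omega>. norm (x j \<omega> - xstar))) / (\<Sum>j\<le>k. \<gamma> j powr r)" .
      qed
    qed (auto intro!: always_eventually integral_nonneg_AE)
    then show ?thesis using xbar_int by blast
  qed
  ultimately show ?thesis by blast
qed

end
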